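(* Let $\Omega_0,T_0\ge2$ and $\varepsilon_T,\varepsilon_\Omega>0$. Let $f\in L^2(\mathbb R)$ satisfy $$\int_{|t|>T_0}|f(t)|^2\,dt\le\varepsilon_T^2\|f\|_{L^2(\mathbb R)}^2\qquad\text{and}\qquad\int_{|\omega|>\Omega_0}|\hat f(\omega)|^2\,d\omega\le\varepsilon_\Omega^2\|f\|_{L^2(\mathbb R)}^2.$$ For an integer $n$, let $K_nf=\sum_{k=0}^n\langle f,h_k\rangle h_k$ be the orthogonal projection of $f$ onto $\mathrm{span}(h_0,\dots,h_n)$. Let $T\ge T_0$ and assume $n\ge\max(2T^2,2\Omega_0^2)$. Then $$\|f-K_nf\|_{L^2([-T,T])}\le\left(2\varepsilon_T+\varepsilon_\Omega+\frac{34T^3}{\sqrt{2n+1}}\right)\|f\|_{L^2(\mathbb R)}.$$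
   Context: For an integer $n\ge0$, $H_n(x)=(-1)^n e^{x^2}\frac{d^n}{dx^n}e^{-x^2}$ is the $n$-th Hermite polynomial and $h_n(x)=\frac{1}{\pi^{1/4}\sqrt{2^n n!}}H_n(x)e^{-x^2/2}$ is the $n$-th Hermite function; $(h_n)_{n\ge0}$ is an orthonormal basis of $L^2(\mathbb R)$. The Fourier transform is normalized as $\hat f(\omega)=\frac{1}{\sqrt{2\pi}}\int_{\mathbb R}f(t)e^{-it\omega}\,dt$ for $f\in L^1(\mathbb R)$, extended to a unitary operator on $L^2(\mathbb R)$. *)

theory Defs
  imports "HOL-Analysis.Analysis"
begin

definition hermite_poly :: "nat \<Rightarrow> real \<Rightarrow> real" where
  "hermite_poly n x = (-1) ^ n * exp (x\<^sup>2) * ((deriv ^^ n) (\<lambda>y. exp (- (y\<^sup>2))) x)"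

definition hermite_fun :: "nat \<Rightarrow> real \<Rightarrow> real" where
  "hermite_fun n x = 1 / (pi powr (1/4) * sqrt (2 ^ n * fact n)) * hermite_poly n x * exp (- (x\<^sup>2) / 2)"

definition square_integrable :: "(real \<Rightarrow> complex) \<Rightarrow> bool" where
  "square_integrable f \<longleftrightarrow> f \<in> borel_measurable lborel \<and> integrable lborel (\<lambda>t. (cmod (f t))\<^sup>2)"

definition L2_norm_R :: "(real \<Rightarrow> complex) \<Rightarrow> real" where
  "L2_norm_R f = sqrt (LINT t|lborel. (cmod (f t))\<^sup>2)"

definition L2_norm_on :: "real set \<Rightarrow> (real \<Rightarrow> complex) \<Rightarrow> real" where
  "L2_norm_on S f = sqrt (LINT t:S|lborel. (cmod (f t))\<^sup>2)"

definition L2_inner :: "(real \<Rightarrow> complex) \<Rightarrow> (real \<Rightarrow> complex) \<Rightarrow> complex" where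
  "L2_inner f g = (LINT t|lborel. f t * cnj (g t))"

text \<open>Plancherel Fourier transform on L^2: F is the L^2-limit as R \<rightarrow> \<infinity> of the
  truncated transforms (1/sqrt(2 pi)) \<integral>_{-R}^{R} f(t) e^{-i t \<omega>} dt.\<close>
definition is_fourier_L2 :: "(real \<Rightarrow> complex) \<Rightarrow> (real \<Rightarrow> complex) \<Rightarrow> bool" where
  "is_fourier_L2 f F \<longleftrightarrow> square_integrable F \<and>
     ((\<lambda>R. LINT \<omega>|lborel. (cmod (F \<omega> -
        complex_of_real (1 / sqrt (2 * pi)) * (LINT t:{-R..R}|lborel. f t * cis (- (t * \<omega>)))))\<^sup>2)
      \<longlongrightarrow> 0) at_top"

definition hermite_proj :: "nat \<Rightarrow> (real \<Rightarrow> complex) \<Rightarrow> real \<Rightarrow> complex" where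
  "hermite_proj n f t = (\<Sum>k\<le>n. L2_inner f (\<lambda>x. complex_of_real (hermite_fun k x)) * complex_of_real (hermite_fun k t))"

end

(*
  Put mu = sqrt (2n + 2). On the n-th and (n+1)-st Hermite functions a, b the ladder operators act as
  a' = x a - mu b, b' = -x b + mu a, a rotation of frequency mu perturbed by a term of size |x|.
  By the telescoping of the ladder relations the kernel k(x,y) of the projection K_n satisfies
  (d/dx + d/dy) k = -(mu/2) (b(x) a(y) + a(x) b(y)), which oscillates along the diagonal direction, so
  k(x,y) differs from k((x-y)/2, -(x-y)/2) by O(T^2/mu) on [-T,T]^2. By Christoffel-Darboux the latter is
  a product a b divided by x - y, and variation of constants together with Wallis' product for a(0), b(0)
  gives |k(x,y) - sin(mu(x-y))/(pi(x-y))| <= 7 T^2/mu. So K_n is, on functions supported in [-T,T],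
  within 14 T^3/mu of the projection onto frequencies |omega| <= mu; as mu >= Omega0, the rest is
  Plancherel, Bessel and Cauchy-Schwarz, tested against the restriction of f - K_n f to [-T,T].
  If 4T > mu the claimed bound already follows from Bessel's inequality.
*)

theory Submission
  imports Defs "HOL-Probability.Probability"
begin

section \<open>Hermite functions\<close>

text \<open>The obstacle is that the perturbation of the rotation has size |x|, not 1/mu: integrated
  over [-T,T] it is of order T^2, too large for a direct perturbation argument. It acts only through
  oscillating factors, however. Each estimate therefore first subtracts an explicit quadratic
  expression in the two functions whose derivative reproduces the oscillating part; only the
  remainder is bounded in absolute value. Since the energy a^2 + b^2 is itself O(1/mu), all errors
  come out as O(T^2/mu). The detour over the antidiagonal also has a reason: an error in the
  Christoffel-Darboux numerator gets divided by x - y. On the antidiagonal, parity turns the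
  numerator into a function of one variable that vanishes at 0, and its error carries the factor |x
  - y|. The transform F is given only as a limit in the mean, so pairings are made with functions
  supported in [-T,T], whose transforms are ordinary integrals; F enters only through its tail.
  There the truncation of f costs one epsilon_T; the second one arises because K_n also acts on the
  part of f outside [-T,T].\<close>

primrec hermite_rpoly :: "nat \<Rightarrow> real poly" where
  "hermite_rpoly 0 = 1"
| "hermite_rpoly (Suc n) = [:0, 2:] * hermite_rpoly n - pderiv (hermite_rpoly n)"

lemma iterated_deriv_gauss:
  "(deriv ^^ n) (\<lambda>y::real. exp (- (y\<^sup>2))) = (\<lambda>x. (-1) ^ n * poly (hermite_rpoly n) x * exp (- (x\<^sup>2)))"
proof (induction n)
  case 0
  then show ?case by simp
next
  case (Suc n)
  have "((\<lambda>x. (-1) ^ n * poly (hermite_rpoly n) x * exp (- (x\<^sup>2))) has_real_derivative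
     (-1) ^ Suc n * poly (hermite_rpoly (Suc n)) x * exp (- (x\<^sup>2))) (at x)" for x
    by (auto intro!: derivative_eq_intros simp: algebra_simps)
  then show ?case
    using Suc by (auto simp: DERIV_imp_deriv)
qed

lemma hermite_poly_eq: "hermite_poly n x = poly (hermite_rpoly n) x"
  unfolding hermite_poly_def iterated_deriv_gauss
proof -
  have "(-1::real) ^ n * (-1) ^ n = 1"
    by (simp flip: power_mult_distrib)
  moreover have "exp (x\<^sup>2) * exp (- (x\<^sup>2)) = 1"
    by (simp flip: exp_add)
  ultimately show "(-1) ^ n * exp (x\<^sup>2) * ((-1) ^ n * poly (hermite_rpoly n) x * exp (- (x\<^sup>2))) = poly (hermite_rpoly n) x"
    by (simp add: mult_ac)
qed

text \<open>Differentiating the defining recursion and inserting the induction hypothesis reproduces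
  that recursion one degree lower. This is the lowering relation, the counterpart of the raising
  relation built into \<open>hermite_rpoly\<close>.\<close>

lemma pderiv_hermite_rpoly:
  "pderiv (hermite_rpoly (Suc n)) = smult (2 * (real n + 1)) (hermite_rpoly n)"
proof (induction n)
  case 0
  then show ?case by (simp add: pderiv_pCons)
next
  case (Suc n)
  have "pderiv (hermite_rpoly (Suc (Suc n))) = pderiv ([:0, 2:] * hermite_rpoly (Suc n) - pderiv (hermite_rpoly (Suc n)))"
    by simp
  also have "\<dots> = smult 2 (hermite_rpoly (Suc n)) + [:0,2:] * smult (2 * (real n + 1)) (hermite_rpoly n)
       - smult (2 * (real n + 1)) (pderiv (hermite_rpoly n))"
    by (simp only: pderiv_diff pderiv_mult Suc.IH pderiv_smult) (simp add: pderiv_pCons)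
  also have "\<dots> = smult (2 * (real (Suc n) + 1)) (hermite_rpoly (Suc n))"
    by (simp add: poly_eq_poly_eq_iff[symmetric] fun_eq_iff algebra_simps)
  finally show ?case .
qed

definition hermite_norm :: "nat \<Rightarrow> real" where
  "hermite_norm n = 1 / (pi powr (1/4) * sqrt (2 ^ n * fact n))"

lemma hermite_norm_Suc: "hermite_norm n = sqrt (2 * real n + 2) * hermite_norm (Suc n)"
proof -
  have "sqrt (2 ^ Suc n * fact (Suc n)) = sqrt (2 * real n + 2) * sqrt (2 ^ n * fact n)"
    by (simp add: algebra_simps flip: real_sqrt_mult)
  then show ?thesis
    by (simp add: hermite_norm_def del: fact_Suc power_Suc)
qed

lemma hermite_fun_eq: "hermite_fun n x = hermite_norm n * poly (hermite_rpoly n) x * exp (- (x\<^sup>2) / 2)"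
  by (simp add: hermite_fun_def hermite_norm_def hermite_poly_eq)

section \<open>Ladder relations, parity and the Christoffel-Darboux formula\<close>

lemma hermite_fun_deriv:
  "(hermite_fun n has_real_derivative x * hermite_fun n x - sqrt (2 * real n + 2) * hermite_fun (Suc n) x) (at x)"
proof -
  have "((\<lambda>x. hermite_norm n * poly (hermite_rpoly n) x * exp (- (x\<^sup>2) / 2)) has_real_derivative
      x * (hermite_norm n * poly (hermite_rpoly n) x * exp (- (x\<^sup>2) / 2))
      - hermite_norm n * poly (hermite_rpoly (Suc n)) x * exp (- (x\<^sup>2) / 2)) (at x)"
    by (auto intro!: derivative_eq_intros simp: algebra_simps)
  then show ?thesis
    unfolding hermite_fun_eq[abs_def] by (subst (asm) (3) hermite_norm_Suc) (simp add: mult_ac)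
qed

lemma hermite_fun_Suc_deriv:
  "(hermite_fun (Suc n) has_real_derivative - x * hermite_fun (Suc n) x + sqrt (2 * real n + 2) * hermite_fun n x) (at x)"
proof -
  have s: "sqrt (2 * real n + 2) * sqrt (2 * real n + 2) = 2 * real n + 2" by simp
  have "((\<lambda>x. hermite_norm (Suc n) * poly (hermite_rpoly (Suc n)) x * exp (- (x\<^sup>2) / 2)) has_real_derivative
      - x * (hermite_norm (Suc n) * poly (hermite_rpoly (Suc n)) x * exp (- (x\<^sup>2) / 2))
      + (sqrt (2 * real n + 2) * sqrt (2 * real n + 2)) * hermite_norm (Suc n) * poly (hermite_rpoly n) x * exp (- (x\<^sup>2) / 2)) (at x)"
    unfolding s
    by (rule derivative_eq_intros poly_DERIV refl | simp only: pderiv_hermite_rpoly)+ (simp add: algebra_simps)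
  then show ?thesis
    unfolding hermite_fun_eq[abs_def] hermite_norm_Suc[of n] by (simp only: mult_ac)
qed

lemma hermite_fun_0: "hermite_fun 0 x = exp (- (x\<^sup>2) / 2) / pi powr (1/4)"
  by (simp add: hermite_fun_eq hermite_norm_def)

lemma hermite_fun_0_deriv: "(hermite_fun 0 has_real_derivative - x * hermite_fun 0 x) (at x)"
  unfolding hermite_fun_0[abs_def] by (auto intro!: derivative_eq_intros)

lemma hermite_fun_1: "sqrt 2 * hermite_fun (Suc 0) x = 2 * x * hermite_fun 0 x"
  using DERIV_unique[OF hermite_fun_deriv[of 0 x] hermite_fun_0_deriv] by simp

text \<open>The function of index \<open>Suc n\<close> can be differentiated by raising or by
  lowering; equating the two results gives the three-term recurrence.\<close>

lemma hermite_fun_Suc_Suc: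
  "sqrt (2 * real n + 4) * hermite_fun (Suc (Suc n)) x = 2 * x * hermite_fun (Suc n) x - sqrt (2 * real n + 2) * hermite_fun n x"
  using DERIV_unique[OF hermite_fun_deriv[of "Suc n" x] hermite_fun_Suc_deriv] by (simp add: algebra_simps)

lemma hermite_fun_minus: "hermite_fun n (- x) = (-1) ^ n * hermite_fun n x"
proof (induction n rule: less_induct)
  case (less n)
  consider "n = 0" | "n = 1" | m where "n = Suc (Suc m)"
    by (metis One_nat_def not0_implies_Suc)
  then show ?case
  proof cases
    case 1
    then show ?thesis by (simp add: hermite_fun_0)
  next
    case 2
    have "sqrt 2 * hermite_fun 1 (-x) = sqrt 2 * (- hermite_fun 1 x)"
      using hermite_fun_1[of x] hermite_fun_1[of "-x"] by (simp add: hermite_fun_0)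
    then have "hermite_fun 1 (-x) = - hermite_fun 1 x"
      by (subst (asm) mult_cancel_left) simp
    then show ?thesis using 2 by simp
  next
    case 3
    have "sqrt (2 * real m + 4) * hermite_fun n (- x) = sqrt (2 * real m + 4) * ((-1) ^ n * hermite_fun n x)"
    proof -
      have "sqrt (2 * real m + 4) * hermite_fun n (- x)
          = (-1) ^ m * (2 * x * hermite_fun (Suc m) x - sqrt (2 * real m + 2) * hermite_fun m x)"
        using hermite_fun_Suc_Suc[of m "-x"] less[of m] less[of "Suc m"] 3 by (simp add: algebra_simps)
      also have "\<dots> = sqrt (2 * real m + 4) * ((-1) ^ n * hermite_fun n x)"
        using hermite_fun_Suc_Suc[of m x] 3 by simp
      finally show ?thesis .
    qed
    then show ?thesis
      by (subst (asm) mult_cancel_left) simp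
  qed
qed

definition hermite_kernel :: "nat \<Rightarrow> real \<Rightarrow> real \<Rightarrow> real" where
  "hermite_kernel n x y = (\<Sum>k\<le>n. hermite_fun k x * hermite_fun k y)"

text \<open>Multiplying the new summand by 2(x - y) and applying the three-term recurrence in each
  variable gives the bracket of the next index plus a leftover, which cancels the bracket of the
  induction hypothesis.\<close>

lemma Christoffel_Darboux:
  "2 * (x - y) * hermite_kernel n x y = sqrt (2 * real n + 2) *
     (hermite_fun (Suc n) x * hermite_fun n y - hermite_fun n x * hermite_fun (Suc n) y)"
proof (induction n)
  case 0
  show ?case
    using hermite_fun_1[of x] hermite_fun_1[of y]
    by (simp add: hermite_kernel_def algebra_simps)
next
  case (Suc n)
  have "2 * (x - y) * hermite_kernel (Suc n) x y = 2 * (x - y) * hermite_kernel n x y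
      + (2 * x * hermite_fun (Suc n) x) * hermite_fun (Suc n) y
      - hermite_fun (Suc n) x * (2 * y * hermite_fun (Suc n) y)"
    by (simp add: hermite_kernel_def algebra_simps)
  also have "2 * x * hermite_fun (Suc n) x = sqrt (2 * real n + 4) * hermite_fun (Suc (Suc n)) x + sqrt (2 * real n + 2) * hermite_fun n x"
    using hermite_fun_Suc_Suc[of n x] by simp
  also have "2 * y * hermite_fun (Suc n) y = sqrt (2 * real n + 4) * hermite_fun (Suc (Suc n)) y + sqrt (2 * real n + 2) * hermite_fun n y"
    using hermite_fun_Suc_Suc[of n y] by simp
  finally show ?case
    unfolding Suc.IH by (simp add: algebra_simps)
qed

section \<open>Orthonormality of the Hermite functions\<close>

lemma integrable_poly_gauss: "integrable lborel (\<lambda>x::real. poly p x * exp (- (x\<^sup>2)))"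
proof -
  have m: "integrable lborel (\<lambda>x::real. x ^ k * exp (- (x\<^sup>2)))" for k
  proof (rule Bochner_Integration.integrable_bound)
    show "integrable lborel (\<lambda>x::real. sqrt (2 * pi) * (std_normal_density x * \<bar>x\<bar> ^ k))"
      by (intro integrable_mult_right integrable_std_normal_moment_abs)
    show "AE x in lborel. norm (x ^ k * exp (- (x\<^sup>2))) \<le> norm (sqrt (2 * pi) * (std_normal_density x * \<bar>x\<bar> ^ k))" for x :: real
    proof (rule AE_I2)
      fix x :: real
      have "norm (x ^ k * exp (- (x\<^sup>2))) = \<bar>x\<bar> ^ k * exp (- (x\<^sup>2))"
        by (simp add: abs_mult power_abs)
      also have "\<dots> \<le> \<bar>x\<bar> ^ k * exp (- (x\<^sup>2) / 2)"
        by (intro mult_left_mono) auto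
      also have "\<dots> = norm (sqrt (2 * pi) * (std_normal_density x * \<bar>x\<bar> ^ k))"
        by (simp add: normal_density_def abs_mult)
      finally show "norm (x ^ k * exp (- (x\<^sup>2))) \<le> norm (sqrt (2 * pi) * (std_normal_density x * \<bar>x\<bar> ^ k))" .
    qed
  qed simp
  show ?thesis
    unfolding poly_altdef sum_distrib_right
    by (intro Bochner_Integration.integrable_sum) (simp add: mult.assoc m)
qed

lemma poly_gauss_tendsto_0: "((\<lambda>x::real. poly p x * exp (- (x\<^sup>2))) \<longlongrightarrow> 0) at_top"
proof -
  have "((\<lambda>x::real. x ^ k * exp (- (x\<^sup>2))) \<longlongrightarrow> 0) at_top" for k
  proof (rule Lim_null_comparison)
    show "((\<lambda>x::real. x ^ k / exp x) \<longlongrightarrow> 0) at_top"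
      by (rule tendsto_power_div_exp_0)
    show "\<forall>\<^sub>F x in at_top. norm (x ^ k * exp (- (x\<^sup>2))) \<le> x ^ k / exp (x::real)"
      using eventually_ge_at_top[of "1::real"]
    proof eventually_elim
      case (elim x)
      then have "x \<le> x\<^sup>2" by (simp add: power2_eq_square)
      then have "exp (- (x\<^sup>2)) \<le> exp (- x)" by simp
      then show ?case using elim by (simp add: abs_mult exp_minus field_simps)
    qed
  qed
  then show ?thesis
    unfolding poly_altdef sum_distrib_right
    by (intro tendsto_null_sum) (simp add: mult.assoc tendsto_mult_right_zero)
qed

text \<open>The integrand is the derivative of \<open>poly p x * exp (- (x\<^sup>2))\<close>, which
  tends to 0 at both ends. This is the integration by parts behind orthogonality.\<close>

lemma integral_deriv_poly_gauss:
  fixes p :: "real poly"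
  shows "(LINT x|lborel. poly (pderiv p - [:0,2:] * p) x * exp (- (x\<^sup>2))) = 0"
proof -
  let ?F = "\<lambda>x::real. poly p x * exp (- (x\<^sup>2))"
  let ?f = "\<lambda>x::real. poly (pderiv p - [:0,2:] * p) x * exp (- (x\<^sup>2))"
  have bot: "(?F \<longlongrightarrow> 0) at_bot"
    using poly_gauss_tendsto_0[of "pcompose p [:0,-1:]"]
    by (subst filterlim_at_bot_mirror) (simp add: poly_pcompose)
  have "(LBINT x=-\<infinity>..\<infinity>. ?f x) = 0 - 0"
  proof (rule interval_integral_FTC_integrable)
    show "((?F \<circ> real_of_ereal) \<longlongrightarrow> 0) (at_right (-\<infinity>))"
      using bot by (simp add: ereal_tendsto_simps)
    show "((?F \<circ> real_of_ereal) \<longlongrightarrow> 0) (at_left \<infinity>)"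
      using poly_gauss_tendsto_0 by (simp add: ereal_tendsto_simps)
    show "(?F has_vector_derivative ?f x) (at x)" for x
      unfolding has_real_derivative_iff_has_vector_derivative[symmetric]
      by (auto intro!: derivative_eq_intros simp: algebra_simps)
    show "set_integrable lborel (einterval (-\<infinity>) \<infinity>) ?f"
      using integrable_poly_gauss[of "pderiv p - [:0,2:] * p"]
      by (simp add: set_integrable_def del: poly_diff poly_mult)
  qed (auto intro!: continuous_intros)
  then show ?thesis
    by (simp add: interval_integral_to_infinity_eq interval_lebesgue_integral_def set_lebesgue_integral_def)
qed

lemma hermite_fun_mult:
  "hermite_fun m x * hermite_fun n x = poly (smult (hermite_norm m * hermite_norm n) (hermite_rpoly m * hermite_rpoly n)) x * exp (- (x\<^sup>2))"
proof -
  have "exp (- (x\<^sup>2)) = exp (- (x\<^sup>2)/2) * exp (- (x\<^sup>2)/2)"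
    by (simp flip: exp_add)
  then show ?thesis by (simp add: hermite_fun_eq)
qed

lemma integrable_hermite_fun_mult: "integrable lborel (\<lambda>x. hermite_fun m x * hermite_fun n x)"
  unfolding hermite_fun_mult by (rule integrable_poly_gauss)

text \<open>Integration by parts freed from polynomials: \<open>D\<close> may be whatever form the
  ladder relations give to the derivative, so relations between Gram entries can be read off from
  it.\<close>

lemma integral_hermite_fun_mult_deriv:
  assumes "\<And>x. ((\<lambda>x. hermite_fun m x * hermite_fun n x) has_real_derivative D x) (at x)"
  shows "(LINT x|lborel. D x) = 0"
proof -
  let ?p = "smult (hermite_norm m * hermite_norm n) (hermite_rpoly m * hermite_rpoly n)"
  have "D x = poly (pderiv ?p - [:0,2:] * ?p) x * exp (- (x\<^sup>2))" for x
  proof (rule DERIV_unique[OF assms])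
    show "((\<lambda>x. hermite_fun m x * hermite_fun n x) has_real_derivative
         poly (pderiv ?p - [:0,2:] * ?p) x * exp (- (x\<^sup>2))) (at x)"
      unfolding hermite_fun_mult
      by (rule derivative_eq_intros poly_DERIV refl)+ (simp add: algebra_simps)
  qed
  then show ?thesis using integral_deriv_poly_gauss[of ?p] by simp
qed

lemma hermite_gram_0_Suc: "(LINT x|lborel. hermite_fun 0 x * hermite_fun (Suc n) x) = 0"
proof -
  have "((\<lambda>x. hermite_fun 0 x * hermite_fun n x) has_real_derivative
      - (sqrt (2 * real n + 2) * (hermite_fun 0 x * hermite_fun (Suc n) x))) (at x)" for x
    by (rule derivative_eq_intros hermite_fun_0_deriv hermite_fun_deriv)+ (simp add: algebra_simps)
  from integral_hermite_fun_mult_deriv[OF this] show ?thesis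
    by (simp add: add_eq_0_iff)
qed

text \<open>In the derivative of the product with indices \<open>Suc m\<close> and \<open>n\<close>,
  lowering one factor and raising the other makes the terms with x cancel. The relation lowers both
  indices together until one of them is 0.\<close>

lemma hermite_gram_Suc_Suc:
  "sqrt (2 * real n + 2) * (LINT x|lborel. hermite_fun (Suc m) x * hermite_fun (Suc n) x)
   = sqrt (2 * real m + 2) * (LINT x|lborel. hermite_fun m x * hermite_fun n x)"
proof -
  have "((\<lambda>x. hermite_fun (Suc m) x * hermite_fun n x) has_real_derivative
      sqrt (2 * real m + 2) * (hermite_fun m x * hermite_fun n x)
      - sqrt (2 * real n + 2) * (hermite_fun (Suc m) x * hermite_fun (Suc n) x)) (at x)" for x
    by (rule derivative_eq_intros hermite_fun_Suc_deriv hermite_fun_deriv)+ (simp add: algebra_simps)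
  from integral_hermite_fun_mult_deriv[OF this] show ?thesis
    by (simp add: integrable_hermite_fun_mult)
qed

lemma hermite_gram_00: "(LINT x|lborel. hermite_fun 0 x * hermite_fun 0 x) = 1"
proof -
  have e: "hermite_fun 0 x * hermite_fun 0 x = normal_density 0 (1 / sqrt 2) x" for x
  proof -
    have "pi powr (1/4) * pi powr (1/4) = sqrt pi"
      by (simp add: powr_half_sqrt flip: powr_add)
    moreover have "exp (- (x\<^sup>2) / 2) * exp (- (x\<^sup>2) / 2) = exp (- (x\<^sup>2))"
      by (simp flip: exp_add)
    ultimately show ?thesis
      by (simp add: hermite_fun_0 normal_density_def power_divide)
  qed
  show ?thesis unfolding e by (rule integral_normal_density) simp
qed

lemma hermite_orthonormal:
  "(LINT x|lborel. hermite_fun m x * hermite_fun n x) = (if m = n then 1 else 0)"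
proof (induction n arbitrary: m)
  case 0
  show ?case
    using hermite_gram_0_Suc by (cases m) (auto simp: hermite_gram_00 mult.commute)
next
  case (Suc n)
  show ?case
  proof (cases m)
    case 0
    then show ?thesis by (simp add: hermite_gram_0_Suc)
  next
    case (Suc l)
    then show ?thesis
      using hermite_gram_Suc_Suc[of n l] Suc.IH[of l] by (auto simp: add_eq_0_iff split: if_splits)
  qed
qed

section \<open>Comparison of the Hermite kernel with the sinc kernel\<close>

lemma hermite_fun_odd_0: "hermite_fun (Suc (2 * m)) 0 = 0"
  using hermite_fun_minus[of "Suc (2 * m)" 0] by simp

lemma hermite_fun_even_0: "(hermite_fun (2 * Suc m) 0)\<^sup>2 = (2 * real m + 1) / (2 * real m + 2) * (hermite_fun (2 * m) 0)\<^sup>2"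
proof -
  have "(sqrt (4 * real m + 4) * hermite_fun (2 * Suc m) 0)\<^sup>2 = (sqrt (4 * real m + 2) * hermite_fun (2 * m) 0)\<^sup>2"
    using hermite_fun_Suc_Suc[of "2 * m" 0] by simp
  then have "(4 * real m + 4) * (hermite_fun (2 * Suc m) 0)\<^sup>2 = (4 * real m + 2) * (hermite_fun (2 * m) 0)\<^sup>2"
    by (simp add: power_mult_distrib)
  then show ?thesis by (simp add: field_simps)
qed

text \<open>Passing from m to m + 1 multiplies the first two factors by (2m+1)(2m+3)/(2m+2)^2, the
  reciprocal of the new Wallis factor. Fourth powers appear because the recursion for the squares
  has the ratio (2m+1)/(2m+2), which must itself be squared to match.\<close>

lemma hermite_fun_even_0_wallis:
  "(2 * real m + 1) * (hermite_fun (2 * m) 0) ^ 4 * (\<Prod>k=1..m. (4 * real k ^ 2) / (4 * real k ^ 2 - 1)) = 1 / pi"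
proof (induction m)
  case 0
  have "(pi powr (1/4)) ^ 4 = pi"
    by (simp add: powr_power)
  then show ?case by (simp add: hermite_fun_0 power_divide)
next
  case (Suc m)
  have p4: "z ^ 4 = (z\<^sup>2)\<^sup>2" for z :: real by simp
  have e: "(2 * real (Suc m) + 1) * (hermite_fun (2 * Suc m) 0) ^ 4 * ((4 * real (Suc m) ^ 2) / (4 * real (Suc m) ^ 2 - 1))
      = (2 * real m + 1) * (hermite_fun (2 * m) 0) ^ 4"
  proof -
    have d: "4 * real (Suc m) ^ 2 - 1 = (2 * real m + 1) * (2 * real m + 3)"
      by (simp add: power2_eq_square algebra_simps)
    show ?thesis
      unfolding d p4[of "hermite_fun (2 * Suc m) 0"] p4[of "hermite_fun (2 * m) 0"] hermite_fun_even_0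
      by (simp add: divide_simps) (simp add: algebra_simps power2_eq_square)
  qed
  have "(2 * real (Suc m) + 1) * (hermite_fun (2 * Suc m) 0) ^ 4 * (\<Prod>k=1..Suc m. (4 * real k ^ 2) / (4 * real k ^ 2 - 1))
     = ((2 * real (Suc m) + 1) * (hermite_fun (2 * Suc m) 0) ^ 4 * ((4 * real (Suc m) ^ 2) / (4 * real (Suc m) ^ 2 - 1)))
        * (\<Prod>k=1..m. (4 * real k ^ 2) / (4 * real k ^ 2 - 1))"
    by (simp add: mult_ac)
  then show ?case unfolding e Suc .
qed

lemma hermite_fun_even_0_tendsto: "(\<lambda>m. (2 * real m + 1) * (hermite_fun (2 * m) 0) ^ 4) \<longlonglongrightarrow> 2 / pi\<^sup>2"
proof -
  let ?W = "\<lambda>m. \<Prod>k=1..m. (4 * real k ^ 2) / (4 * real k ^ 2 - 1)"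
  have "(\<lambda>m. 1 / pi / ?W m) \<longlonglongrightarrow> 1 / pi / (pi / 2)"
    by (intro tendsto_divide tendsto_const wallis) simp
  moreover have "1 / pi / ?W m = (2 * real m + 1) * (hermite_fun (2 * m) 0) ^ 4" for m
  proof -
    have "?W m \<noteq> 0" using hermite_fun_even_0_wallis[of m] by (metis divide_eq_0_iff mult_zero_right one_neq_zero pi_neq_zero)
    then show ?thesis using hermite_fun_even_0_wallis[of m] by (simp add: field_simps)
  qed
  ultimately show ?thesis by (simp add: power2_eq_square)
qed

text \<open>A decreasing sequence stays above its limit; the step ratio (2m+1)(2m+3)/(2m+2)^2 is
  below 1. Together with the increasing companion below it brackets the limit at every m, which
  serves in place of a convergence rate for Wallis' product. The weights 2m + 1 and 2m are mu^2/2
  for n = 2m and n = 2m - 1.\<close>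

lemma hermite_fun_even_0_ge: "2 / pi\<^sup>2 \<le> (2 * real m + 1) * (hermite_fun (2 * m) 0) ^ 4"
proof (rule decseq_ge[OF _ hermite_fun_even_0_tendsto])
  show "decseq (\<lambda>m. (2 * real m + 1) * (hermite_fun (2 * m) 0) ^ 4)"
  proof (rule decseq_SucI)
    fix m
    have "(2 * real (Suc m) + 1) * (hermite_fun (2 * Suc m) 0) ^ 4
        = ((2 * real m + 3) * (2 * real m + 1) / (2 * real m + 2)\<^sup>2) * ((2 * real m + 1) * ((hermite_fun (2 * m) 0)\<^sup>2)\<^sup>2)"
      using arg_cong[OF hermite_fun_even_0[of m], of "\<lambda>z. z\<^sup>2"]
      by (simp add: power_mult_distrib power_divide) (simp add: divide_simps power2_eq_square algebra_simps)
    also have "\<dots> \<le> 1 * ((2 * real m + 1) * ((hermite_fun (2 * m) 0)\<^sup>2)\<^sup>2)"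
    proof (rule mult_right_mono)
      show "(2 * real m + 3) * (2 * real m + 1) / (2 * real m + 2)\<^sup>2 \<le> 1"
        by (subst pos_divide_le_eq) (simp, simp add: power2_eq_square algebra_simps)
    qed simp
    finally show "(2 * real (Suc m) + 1) * (hermite_fun (2 * Suc m) 0) ^ 4 \<le> (2 * real m + 1) * (hermite_fun (2 * m) 0) ^ 4"
      by simp
  qed
qed

text \<open>With the weight 2m the step ratio is (2m+1)^2/(2m(2m+2)) for m >= 1, which exceeds 1, so
  the same limit is now approached from below.\<close>

lemma hermite_fun_even_0_le: "2 * real m * (hermite_fun (2 * m) 0) ^ 4 \<le> 2 / pi\<^sup>2"
proof (rule incseq_le[of "\<lambda>m. 2 * real m * (hermite_fun (2 * m) 0) ^ 4" "2 / pi\<^sup>2" m])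
  show "incseq (\<lambda>m. 2 * real m * (hermite_fun (2 * m) 0) ^ 4)"
  proof (rule incseq_SucI)
    fix m
    have "2 * real m * (hermite_fun (2 * m) 0) ^ 4 = (2 * real m) * ((hermite_fun (2 * m) 0)\<^sup>2)\<^sup>2" by simp
    also have "\<dots> \<le> ((2 * real m + 1)\<^sup>2 / (2 * real m + 2)) * ((hermite_fun (2 * m) 0)\<^sup>2)\<^sup>2"
      by (rule mult_right_mono[OF _ zero_le_power2]) (simp add: divide_simps power2_eq_square algebra_simps)
    also have "\<dots> = 2 * real (Suc m) * (hermite_fun (2 * Suc m) 0) ^ 4"
    proof -
      have "(hermite_fun (2 * Suc m) 0) ^ 4 = ((2 * real m + 1) / (2 * real m + 2) * (hermite_fun (2 * m) 0)\<^sup>2)\<^sup>2"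
        unfolding hermite_fun_even_0[symmetric] by simp
      then have e: "(hermite_fun (2 * Suc m) 0) ^ 4 = ((2 * real m + 1) / (2 * real m + 2))\<^sup>2 * ((hermite_fun (2 * m) 0)\<^sup>2)\<^sup>2"
        by (simp only: power_mult_distrib)
      have "z\<^sup>2 / w * v = w * ((z / w)\<^sup>2 * v)" for z w v :: real
        by (simp add: power_divide power2_eq_square)
      moreover have "2 * real (Suc m) = 2 * real m + 2" by simp
      ultimately show ?thesis unfolding e by (simp only:)
    qed
    finally show "2 * real m * (hermite_fun (2 * m) 0) ^ 4 \<le> 2 * real (Suc m) * (hermite_fun (2 * Suc m) 0) ^ 4" .
  qed
  have "(\<lambda>m. (2 * real m / (2 * real m + 1)) * ((2 * real m + 1) * (hermite_fun (2 * m) 0) ^ 4)) \<longlonglongrightarrow> 1 * (2 / pi\<^sup>2)"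
  proof (intro tendsto_mult hermite_fun_even_0_tendsto)
    show "(\<lambda>m. 2 * real m / (2 * real m + 1)) \<longlonglongrightarrow> 1" by real_asymp
  qed
  moreover have "(2 * real m / (2 * real m + 1)) * ((2 * real m + 1) * (hermite_fun (2 * m) 0) ^ 4) = 2 * real m * (hermite_fun (2 * m) 0) ^ 4" for m
    by (simp add: add_eq_0_iff)
  ultimately show "(\<lambda>m. 2 * real m * (hermite_fun (2 * m) 0) ^ 4) \<longlonglongrightarrow> 2 / pi\<^sup>2" by (simp only: mult_1)
qed

text \<open>The values at 0 are controlled through fourth powers, hence through the square of the
  amplitude. With s = 1/pi this leads back from the square to the amplitude itself.\<close>

lemma abs_diff_le_squares:
  fixes s t :: real
  assumes "0 < s" "0 \<le> t"
  shows "\<bar>t - s\<bar> \<le> \<bar>t\<^sup>2 - s\<^sup>2\<bar> / s"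
proof -
  have "\<bar>t - s\<bar> * s \<le> \<bar>t - s\<bar> * (t + s)"
    using assms by (intro mult_left_mono) auto
  also have "\<dots> = \<bar>t\<^sup>2 - s\<^sup>2\<bar>"
    using assms by (simp add: power2_eq_square square_diff_square_factored abs_mult mult.commute)
  finally show ?thesis using assms by (simp add: field_simps)
qed

text \<open>By parity only the function of even index contributes at 0. The squared amplitude is
  thus half of one of the two bracketing sequences: the decreasing one for even n, the increasing
  one for odd n. Its own bound fixes the sign of the deviation, and the opposite bound, rescaled by
  the ratio of 2m and 2m + 1, limits its size.\<close>

lemma hermite_amplitude:
  assumes "n \<ge> 1"
  shows "\<bar>sqrt (2 * real n + 2) * ((hermite_fun n 0)\<^sup>2 + (hermite_fun (Suc n) 0)\<^sup>2) / 2 - 1 / pi\<bar> \<le> 1 / (2 * real n + 2)"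
proof (cases "even n")
  case True
  then obtain m where m: "n = 2 * m" "m \<ge> 1" using assms by (auto elim!: evenE)
  let ?t = "sqrt (2 * real n + 2) * ((hermite_fun n 0)\<^sup>2 + (hermite_fun (Suc n) 0)\<^sup>2) / 2"
  have t2: "?t\<^sup>2 = (2 * real m + 1) * (hermite_fun (2 * m) 0) ^ 4 / 2"
    by (simp add: m hermite_fun_odd_0 power_mult_distrib power_divide)
  have 1: "?t\<^sup>2 \<ge> (1 / pi)\<^sup>2"
    unfolding t2 using hermite_fun_even_0_ge[of m] by (simp add: power_divide)
  have "(2 * real m) * ((2 * real m + 1) * (hermite_fun (2 * m) 0) ^ 4) \<le> (2 * real m + 1) * (2 / pi\<^sup>2)"
    using mult_left_mono[OF hermite_fun_even_0_le[of m], of "2 * real m + 1"] by (simp add: mult_ac)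
  then have 2: "?t\<^sup>2 - (1 / pi)\<^sup>2 \<le> 1 / (2 * real m * pi\<^sup>2)"
    unfolding t2 using m(2) by (simp add: divide_simps) (simp add: algebra_simps)
  have "\<bar>?t - 1 / pi\<bar> \<le> (1 / (2 * real m * pi\<^sup>2)) / (1 / pi)"
    using abs_diff_le_squares[of "1 / pi" ?t] 1 2
    by (intro order_trans[OF abs_diff_le_squares divide_right_mono]) auto
  also have "\<dots> = 1 / (2 * real m * pi)" by (simp add: power2_eq_square)
  also have "\<dots> \<le> 1 / (2 * real n + 2)"
  proof -
    \<comment> \<open>Here n = 2m, so the claim is 4m + 2 <= 6m; this is where m >= 1
      enters.\<close>
    have "2 * real n + 2 \<le> 2 * real m * 3" using m by simp
    also have "\<dots> \<le> 2 * real m * pi" using pi_gt3 by (intro mult_left_mono) auto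
    finally show ?thesis by (intro divide_left_mono) (use m in auto)
  qed
  finally show ?thesis .
next
  case False
  then obtain l where "n = 2 * l + 1" by (auto elim: oddE)
  then obtain m where m: "Suc n = 2 * m" "m \<ge> 1" "n = Suc (2 * (m - 1))" by (intro that[of "Suc l"]) auto
  let ?t = "sqrt (2 * real n + 2) * ((hermite_fun n 0)\<^sup>2 + (hermite_fun (Suc n) 0)\<^sup>2) / 2"
  have mu: "2 * real n + 2 = 4 * real m" using m(1) by linarith
  have t2: "?t\<^sup>2 = 2 * real m * (hermite_fun (2 * m) 0) ^ 4 / 2"
    unfolding m(1) mu using m(3) hermite_fun_odd_0[of "m - 1"] by (simp add: power_mult_distrib power_divide)
  have 1: "?t\<^sup>2 \<le> (1 / pi)\<^sup>2"
    unfolding t2 using hermite_fun_even_0_le[of m] by (simp add: power_divide)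
  have "(2 * real m) * (2 / pi\<^sup>2) \<le> (2 * real m + 1) * (2 * real m * (hermite_fun (2 * m) 0) ^ 4)"
    using mult_left_mono[OF hermite_fun_even_0_ge[of m], of "2 * real m"] by (simp add: mult_ac)
  then have 2: "(1 / pi)\<^sup>2 - ?t\<^sup>2 \<le> 1 / ((2 * real m + 1) * pi\<^sup>2)"
    unfolding t2 by (simp add: divide_simps add_eq_0_iff) (simp add: algebra_simps)
  have "\<bar>?t - 1 / pi\<bar> \<le> (1 / ((2 * real m + 1) * pi\<^sup>2)) / (1 / pi)"
    using 1 2 by (intro order_trans[OF abs_diff_le_squares divide_right_mono]) auto
  also have "\<dots> = 1 / ((2 * real m + 1) * pi)" by (simp add: power2_eq_square)
  also have "\<dots> \<le> 1 / (2 * real n + 2)"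
  proof -
    have "2 * real n + 2 \<le> (2 * real m + 1) * 2" using mu by simp
    also have "\<dots> \<le> (2 * real m + 1) * pi" using pi_gt3 by (intro mult_left_mono) auto
    finally show ?thesis by (intro divide_left_mono) auto
  qed
  finally show ?thesis .
qed

section \<open>The ladder system as a perturbed rotation\<close>

lemma continuous_hermite_fun [continuous_intros]:
  "continuous_on S f \<Longrightarrow> continuous_on S (\<lambda>x. hermite_fun n (f x))"
  by (rule continuous_on_compose2[of UNIV "hermite_fun n"])
     (auto intro!: DERIV_continuous_on hermite_fun_deriv[THEN DERIV_subset, OF subset_UNIV])

text \<open>A self-bounding argument at a maximum point z of the energy on [-T,T]: the drift of the
  corrected energy and the correction at z are each at most T/mu times the maximum. Under 4T <= mu
  they amount to at most half of it and are absorbed, which yields the factor 2.\<close>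

lemma hermite_energy_bound:
  fixes T :: real
  assumes T: "4 * T \<le> sqrt (2 * real n + 2)" and x: "\<bar>x\<bar> \<le> T"
  shows "(hermite_fun n x)\<^sup>2 + (hermite_fun (Suc n) x)\<^sup>2 \<le> 2 * ((hermite_fun n 0)\<^sup>2 + (hermite_fun (Suc n) 0)\<^sup>2)"
proof -
  define \<mu> where "\<mu> = sqrt (2 * real n + 2)"
  have mu: "\<mu> > 0" by (simp add: \<mu>_def)
  then have mu0: "\<mu> \<noteq> 0" by simp
  let ?a = "hermite_fun n" and ?b = "hermite_fun (Suc n)"
  let ?e = "\<lambda>x. (?a x)\<^sup>2 + (?b x)\<^sup>2"
  have "\<exists>z\<in>{-T..T}. \<forall>y\<in>{-T..T}. ?e y \<le> ?e z"
    using x by (intro continuous_attains_sup) (auto intro!: continuous_intros)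
  then obtain z where z: "z \<in> {-T..T}" "\<And>y. y \<in> {-T..T} \<Longrightarrow> ?e y \<le> ?e z" by blast
  (* the correction term turns the derivative 2x(a^2 - b^2) of the energy into -(2/mu) ab *)
  let ?E = "\<lambda>x. ?e x - 2 * x / \<mu> * (?a x * ?b x)"
  have ab: "\<bar>?a y * ?b y\<bar> \<le> ?e z / 2" if "y \<in> {-T..T}" for y
    using z(2)[OF that] sum_squares_bound[of "\<bar>?a y\<bar>" "\<bar>?b y\<bar>"] by (simp add: abs_mult)
  have "norm (?E z - ?E 0) \<le> ?e z / \<mu> * norm (z - 0)"
  proof (rule field_differentiable_bound[of "{-T..T}"])
    fix y assume "y \<in> {-T..T}"
    show "(?E has_real_derivative - (2 / \<mu>) * (?a y * ?b y)) (at y within {-T..T})"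
      by (rule DERIV_subset[OF _ subset_UNIV], (rule derivative_eq_intros hermite_fun_Suc_deriv hermite_fun_deriv mu0 refl)+)
         (simp only: \<mu>_def[symmetric], use mu in \<open>auto simp: field_simps power2_eq_square\<close>)
    show "norm (- (2 / \<mu>) * (?a y * ?b y)) \<le> ?e z / \<mu>"
      using ab[OF \<open>y \<in> {-T..T}\<close>] mu by (simp add: abs_mult field_simps)
  qed (use z x in auto)
  moreover have "\<bar>2 * z / \<mu> * (?a z * ?b z)\<bar> \<le> T * (?e z / \<mu>)"
  proof -
    have "\<bar>2 * z / \<mu> * (?a z * ?b z)\<bar> = 2 * \<bar>z\<bar> / \<mu> * \<bar>?a z * ?b z\<bar>"
      using mu by (simp add: abs_mult)
    also have "\<dots> \<le> 2 * T / \<mu> * (?e z / 2)"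
      using z(1) mu ab[OF z(1)] by (intro mult_mono divide_right_mono) auto
    finally show ?thesis by simp
  qed
  moreover have "?e z / \<mu> * norm (z - 0) \<le> T * (?e z / \<mu>)"
    using z(1) mu by (subst mult.commute) (intro mult_right_mono, auto)
  moreover have "T * (?e z / \<mu>) \<le> ?e z / 4"
  proof -
    have "(4 * T) * ?e z \<le> \<mu> * ?e z" using T by (intro mult_right_mono) (auto simp: \<mu>_def)
    then show ?thesis using mu by (simp add: field_simps)
  qed
  \<comment> \<open>B is the maximal energy, A the energy at 0, and p, r are the corrections at z
    and at 0: B <= A + |p| + q <= A + B/2.\<close>
  moreover have "B \<le> 2 * A" if "norm ((B - p) - (A - r)) \<le> q" "\<bar>p\<bar> \<le> s" "q \<le> s" "s \<le> B / 4" "r = 0" for A B p q r s :: real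
    using that by (simp add: abs_le_iff)
  ultimately have "?e z \<le> 2 * ?e 0" by fastforce
  with z(2)[of x] x show ?thesis by fastforce
qed

text \<open>The mean of the raising and the lowering formula. Its terms with x cancel and only
  neighbouring indices remain, which is what makes the derivative of the kernel telescope.\<close>

lemma hermite_fun_Suc_deriv':
  "(hermite_fun (Suc n) has_real_derivative
     (sqrt (2 * real n + 2) * hermite_fun n x - sqrt (2 * real n + 4) * hermite_fun (Suc (Suc n)) x) / 2) (at x)"
  using hermite_fun_Suc_deriv[of n x] by (rule DERIV_cong) (use hermite_fun_Suc_Suc[of n x] in simp)

lemma hermite_kernel_diagonal_deriv:
  "((\<lambda>s. hermite_kernel n (c + s) (d + s)) has_real_derivative
     - (sqrt (2 * real n + 2) / 2) * (hermite_fun (Suc n) (c + s) * hermite_fun n (d + s) + hermite_fun n (c + s) * hermite_fun (Suc n) (d + s))) (at s)"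
proof (induction n)
  case 0
  have 1: "sqrt 2 * hermite_fun (Suc 0) y = 2 * y * hermite_fun 0 y" for y by (rule hermite_fun_1)
  have "((\<lambda>s. hermite_fun 0 (c + s) * hermite_fun 0 (d + s)) has_real_derivative
      - (c + s) * hermite_fun 0 (c + s) * hermite_fun 0 (d + s) + hermite_fun 0 (c + s) * (- (d + s) * hermite_fun 0 (d + s))) (at s)"
    by (rule derivative_eq_intros DERIV_chain2[OF hermite_fun_0_deriv] refl)+ (simp add: algebra_simps)
  moreover have "- (c + s) * hermite_fun 0 (c + s) * hermite_fun 0 (d + s) + hermite_fun 0 (c + s) * (- (d + s) * hermite_fun 0 (d + s))
     = - (1/2) * ((sqrt 2 * hermite_fun (Suc 0) (c + s)) * hermite_fun 0 (d + s) + hermite_fun 0 (c + s) * (sqrt 2 * hermite_fun (Suc 0) (d + s)))"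
    unfolding 1 by (simp add: algebra_simps)
  ultimately have "((\<lambda>s. hermite_fun 0 (c + s) * hermite_fun 0 (d + s)) has_real_derivative
     - (1/2) * ((sqrt 2 * hermite_fun (Suc 0) (c + s)) * hermite_fun 0 (d + s) + hermite_fun 0 (c + s) * (sqrt 2 * hermite_fun (Suc 0) (d + s)))) (at s)"
    by (simp only:)
  then show ?case
    by (simp add: hermite_kernel_def distrib_left mult_ac)
next
  case (Suc n)
  have "((\<lambda>s. hermite_kernel n (c + s) (d + s) + hermite_fun (Suc n) (c + s) * hermite_fun (Suc n) (d + s)) has_real_derivative
     - (sqrt (2 * real n + 2) / 2) * (hermite_fun (Suc n) (c + s) * hermite_fun n (d + s) + hermite_fun n (c + s) * hermite_fun (Suc n) (d + s))
     + ((sqrt (2 * real n + 2) * hermite_fun n (c + s) - sqrt (2 * real n + 4) * hermite_fun (Suc (Suc n)) (c + s)) / 2 * hermite_fun (Suc n) (d + s)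
     + hermite_fun (Suc n) (c + s) * ((sqrt (2 * real n + 2) * hermite_fun n (d + s) - sqrt (2 * real n + 4) * hermite_fun (Suc (Suc n)) (d + s)) / 2))) (at s)"
    by (rule derivative_eq_intros Suc DERIV_chain2[OF hermite_fun_Suc_deriv'] refl)+ simp
  then show ?case
    by (rule DERIV_cong[THEN iffD1[OF arg_cong[of _ _ "\<lambda>F. (F has_real_derivative _) (at s)"], rotated]])
       (simp_all add: hermite_kernel_def field_simps)
qed

lemma abs_dot_le_energy:
  fixes p q r s M :: real
  assumes "p\<^sup>2 + q\<^sup>2 \<le> M" "r\<^sup>2 + s\<^sup>2 \<le> M"
  shows "\<bar>p * r + q * s\<bar> \<le> M"
proof -
  have "\<bar>p * r + q * s\<bar> \<le> \<bar>p\<bar> * \<bar>r\<bar> + \<bar>q\<bar> * \<bar>s\<bar>"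
    using abs_triangle_ineq[of "p * r" "q * s"] by (simp add: abs_mult)
  then show ?thesis
    using assms sum_squares_bound[of "\<bar>p\<bar>" "\<bar>r\<bar>"] sum_squares_bound[of "\<bar>q\<bar>" "\<bar>s\<bar>"] by simp
qed

text \<open>The path starts at the antidiagonal point with the same x - y and moves along the
  diagonal direction. After a shift s the coordinates add up to 2s, so the corrected kernel has
  derivative of size at most |s|/2 times M. A path of length at most T gives T^2 M/2, and the
  corrections at both ends add M/2.\<close>

lemma hermite_kernel_near_antidiagonal:
  fixes T M x y :: real
  assumes M: "\<And>z. \<bar>z\<bar> \<le> T \<Longrightarrow> (hermite_fun n z)\<^sup>2 + (hermite_fun (Suc n) z)\<^sup>2 \<le> M"
    and x: "\<bar>x\<bar> \<le> T" and y: "\<bar>y\<bar> \<le> T"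
  shows "\<bar>hermite_kernel n x y - hermite_kernel n ((x - y) / 2) (- (x - y) / 2)\<bar> \<le> (1 + T\<^sup>2) / 2 * M"
proof -
  let ?a = "hermite_fun n" and ?b = "hermite_fun (Suc n)"
  let ?u = "(x - y) / 2" and ?v = "- (x - y) / 2" and ?c = "(x + y) / 2"
  let ?q = "\<lambda>s. ?a (?u + s) * ?a (?v + s) - ?b (?u + s) * ?b (?v + s)"
  let ?r = "\<lambda>s. ?a (?u + s) * ?a (?v + s) + ?b (?u + s) * ?b (?v + s)"
  (* ?q / 4 has the same oscillating leading part of its derivative as the kernel *)
  let ?f = "\<lambda>s. hermite_kernel n (?u + s) (?v + s) - ?q s / 4"
  have M0: "0 \<le> M" using M[OF x] by (smt (verit) zero_le_power2)
  have s: "\<bar>?u + s\<bar> \<le> T" "\<bar>?v + s\<bar> \<le> T" "\<bar>s\<bar> \<le> T" if "s \<in> closed_segment 0 ?c" for s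
  proof -
    have "0 \<le> s \<and> s \<le> ?c \<or> ?c \<le> s \<and> s \<le> 0"
      using that by (simp add: closed_segment_eq_real_ivl split: if_splits)
    then show "\<bar>?u + s\<bar> \<le> T" "\<bar>?v + s\<bar> \<le> T" "\<bar>s\<bar> \<le> T"
      using x y by (auto simp: abs_le_iff field_simps)
  qed
  have q: "\<bar>?q s\<bar> \<le> M" if "s \<in> closed_segment 0 ?c" for s
    using abs_dot_le_energy[of "?a (?u + s)" "?b (?u + s)" M "?a (?v + s)" "- ?b (?v + s)"] M s[OF that] by simp
  have "norm (?f ?c - ?f 0) \<le> T / 2 * M * norm (?c - 0)"
  proof (rule field_differentiable_bound)
    fix s assume t: "s \<in> closed_segment 0 ?c"
    show "(?f has_real_derivative - (s / 2) * ?r s) (at s within closed_segment 0 ?c)"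
      by (rule DERIV_subset[OF _ subset_UNIV],
          (rule derivative_eq_intros hermite_kernel_diagonal_deriv DERIV_chain2[OF hermite_fun_Suc_deriv] DERIV_chain2[OF hermite_fun_deriv] zero_neq_numeral[symmetric] refl)+)
         (simp add: field_simps)
    have "\<bar>s\<bar> / 2 * \<bar>?r s\<bar> \<le> T / 2 * M"
      using s[OF t] M M0 by (intro mult_mono abs_dot_le_energy) auto
    then show "norm (- (s / 2) * ?r s) \<le> T / 2 * M"
      by (simp add: abs_mult)
  qed auto
  also have "\<dots> \<le> T / 2 * M * T"
    using x y M0 by (intro mult_left_mono) auto
  finally have "\<bar>?f ?c - ?f 0\<bar> \<le> T\<^sup>2 / 2 * M" by (simp add: power2_eq_square mult_ac)
  moreover have "?u + ?c = x" "?v + ?c = y" by (simp_all add: field_simps)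
  moreover have "\<bar>A - B\<bar> \<le> (1 + T\<^sup>2) / 2 * M"
    if "\<bar>(A - p / 4) - (B - r / 4)\<bar> \<le> T\<^sup>2 / 2 * M" "\<bar>p\<bar> \<le> M" "\<bar>r\<bar> \<le> M" for A B p r
  proof -
    have "A - B = ((A - p / 4) - (B - r / 4)) + (p - r) / 4" by (simp add: field_simps)
    moreover have "\<bar>p - r\<bar> \<le> 2 * M" using that by linarith
    ultimately have "\<bar>A - B\<bar> \<le> T\<^sup>2 / 2 * M + M / 2" using that(1) by linarith
    then show ?thesis by (simp add: field_simps)
  qed
  ultimately show ?thesis
    using q[of 0] q[of ?c] by fastforce
qed

text \<open>Parity turns the Christoffel-Darboux bracket into 2ab up to sign. Comparing 2ab with its
  value under the pure rotation started at 0 gives an error proportional to |u|, and this factor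
  pays for the division by 4u; the bound is therefore uniform up to the diagonal.\<close>

lemma hermite_kernel_antidiagonal:
  fixes T M u :: real
  assumes M: "\<And>z. \<bar>z\<bar> \<le> T \<Longrightarrow> (hermite_fun n z)\<^sup>2 + (hermite_fun (Suc n) z)\<^sup>2 \<le> M"
    and u: "\<bar>u\<bar> \<le> T" "u \<noteq> 0"
  defines "\<mu> \<equiv> sqrt (2 * real n + 2)"
  shows "\<bar>hermite_kernel n u (- u) - \<mu> * ((hermite_fun n 0)\<^sup>2 + (hermite_fun (Suc n) 0)\<^sup>2) * sin (2 * \<mu> * u) / (4 * u)\<bar> \<le> (3 / 4 + T\<^sup>2) * M"
proof -
  let ?a = "hermite_fun n" and ?b = "hermite_fun (Suc n)"
  have mu: "\<mu> > 0" by (simp add: \<mu>_def)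
  then have mu0: "\<mu> \<noteq> 0" by simp
  have M0: "0 \<le> M" using M[OF u(1)] by (smt (verit) zero_le_power2)
  let ?e = "\<lambda>x. (?a x)\<^sup>2 + (?b x)\<^sup>2"
  (* Removing the particular solution x e / mu makes (phi, psi) a rotation of frequency 2 mu with
     forcing delta = O(1/mu); (alpha, beta) is the pair in the rotating frame. *)
  define \<psi> where "\<psi> = (\<lambda>x. (?a x)\<^sup>2 - (?b x)\<^sup>2)"
  define \<phi> where "\<phi> = (\<lambda>x. 2 * ?a x * ?b x - x * ?e x / \<mu>)"
  define \<delta> where "\<delta> = (\<lambda>x. - (?e x + 2 * x\<^sup>2 * \<psi> x) / \<mu>)"
  have d\<phi>: "(\<phi> has_real_derivative 2 * \<mu> * \<psi> x + \<delta> x) (at x)" for x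
    unfolding \<phi>_def
    by (rule derivative_eq_intros hermite_fun_Suc_deriv hermite_fun_deriv mu0 refl)+
       (simp only: \<mu>_def[symmetric], use mu in \<open>auto simp: \<psi>_def \<delta>_def field_simps power2_eq_square\<close>)
  have d\<psi>: "(\<psi> has_real_derivative - 2 * \<mu> * \<phi> x) (at x)" for x
    unfolding \<psi>_def
    by (rule derivative_eq_intros hermite_fun_Suc_deriv hermite_fun_deriv mu0 refl)+
       (simp only: \<mu>_def[symmetric], use mu in \<open>auto simp: \<phi>_def field_simps power2_eq_square\<close>)
  define \<alpha> where "\<alpha> = (\<lambda>x. \<phi> x * cos (2 * \<mu> * x) - \<psi> x * sin (2 * \<mu> * x))"
  define \<beta> where "\<beta> = (\<lambda>x. \<phi> x * sin (2 * \<mu> * x) + \<psi> x * cos (2 * \<mu> * x))"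
  have \<delta>: "\<bar>\<delta> x\<bar> \<le> (1 + 2 * T\<^sup>2) * M / \<mu>" if "\<bar>x\<bar> \<le> T" for x
  proof -
    have "\<bar>\<psi> x\<bar> \<le> M" using M[OF that] by (simp add: \<psi>_def abs_le_iff) (smt (verit) zero_le_power2)
    moreover have "x\<^sup>2 \<le> T\<^sup>2" using that by (metis abs_ge_zero power2_abs power_mono)
    ultimately have "x\<^sup>2 * \<bar>\<psi> x\<bar> \<le> T\<^sup>2 * M" by (intro mult_mono) auto
    moreover have "\<bar>?e x\<bar> \<le> M" using M[OF that] by simp
    moreover have "\<bar>?e x + 2 * x\<^sup>2 * \<psi> x\<bar> \<le> \<bar>?e x\<bar> + 2 * (x\<^sup>2 * \<bar>\<psi> x\<bar>)"
      by (rule order_trans[OF abs_triangle_ineq]) (simp add: abs_mult)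
    ultimately have "\<bar>?e x + 2 * x\<^sup>2 * \<psi> x\<bar> \<le> (1 + 2 * T\<^sup>2) * M"
      by (simp add: algebra_simps)
    then show ?thesis using mu by (simp add: \<delta>_def abs_divide divide_right_mono flip: abs_minus_cancel[of "?e x + _"])
  qed
  let ?D = "(1 + 2 * T\<^sup>2) * M / \<mu>"
  have D0: "0 \<le> ?D" using M0 mu by simp
  have trig: "\<bar>d * t\<bar> \<le> ?D" if "\<bar>d\<bar> \<le> ?D" "\<bar>t\<bar> \<le> 1" for d t :: real
    using mult_mono[OF that D0 abs_ge_zero] by (simp add: abs_mult)
  have in_T: "\<bar>x\<bar> \<le> T" if "x \<in> {-T..T}" for x :: real using that by auto
  have "norm (\<alpha> u - \<alpha> 0) \<le> ?D * norm (u - 0)"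
  proof (rule field_differentiable_bound[of "{-T..T}"])
    fix x assume "x \<in> {-T..T}"
    show "(\<alpha> has_real_derivative \<delta> x * cos (2 * \<mu> * x)) (at x within {-T..T})"
      unfolding \<alpha>_def
      by (rule DERIV_subset[OF _ subset_UNIV], (rule derivative_eq_intros d\<phi> d\<psi> refl)+) (simp add: algebra_simps)
    show "norm (\<delta> x * cos (2 * \<mu> * x)) \<le> ?D"
      unfolding real_norm_def by (intro trig \<delta> in_T abs_cos_le_one) fact
  qed (use u in auto)
  moreover have "norm (\<beta> u - \<beta> 0) \<le> ?D * norm (u - 0)"
  proof (rule field_differentiable_bound[of "{-T..T}"])
    fix x assume "x \<in> {-T..T}"
    show "(\<beta> has_real_derivative \<delta> x * sin (2 * \<mu> * x)) (at x within {-T..T})"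
      unfolding \<beta>_def
      by (rule DERIV_subset[OF _ subset_UNIV], (rule derivative_eq_intros d\<phi> d\<psi> refl)+) (simp add: algebra_simps)
    show "norm (\<delta> x * sin (2 * \<mu> * x)) \<le> ?D"
      unfolding real_norm_def by (intro trig \<delta> in_T abs_sin_le_one) fact
  qed (use u in auto)
  \<comment> \<open>One of the two functions is odd, hence \<open>\<phi> 0 = 0\<close>; in the
    rotating frame the initial data are 0 and \<open>\<psi> 0\<close>.\<close>
  moreover have ab0: "?a 0 * ?b 0 = 0"
    using hermite_fun_minus[of n 0] hermite_fun_minus[of "Suc n" 0] by (cases "even n") auto
  ultimately have \<alpha>\<beta>: "\<bar>\<alpha> u\<bar> \<le> ?D * \<bar>u\<bar>" "\<bar>\<beta> u - \<psi> 0\<bar> \<le> ?D * \<bar>u\<bar>"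
    by (auto simp: \<alpha>_def \<beta>_def \<phi>_def)
  have "\<phi> u = \<phi> u * ((cos (2 * \<mu> * u))\<^sup>2 + (sin (2 * \<mu> * u))\<^sup>2)" by (simp only: sin_cos_squared_add2 mult_1_right)
  also have "\<dots> = \<alpha> u * cos (2 * \<mu> * u) + \<beta> u * sin (2 * \<mu> * u)"
    unfolding \<alpha>_def \<beta>_def by algebra
  finally have "\<phi> u - \<psi> 0 * sin (2 * \<mu> * u) = \<alpha> u * cos (2 * \<mu> * u) + (\<beta> u - \<psi> 0) * sin (2 * \<mu> * u)"
    by (simp add: algebra_simps)
  also have "\<bar>\<dots>\<bar> \<le> \<bar>\<alpha> u\<bar> * \<bar>cos (2 * \<mu> * u)\<bar> + \<bar>\<beta> u - \<psi> 0\<bar> * \<bar>sin (2 * \<mu> * u)\<bar>"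
    by (metis abs_mult abs_triangle_ineq)
  also have "\<dots> \<le> (?D * \<bar>u\<bar>) * 1 + (?D * \<bar>u\<bar>) * 1"
    using \<alpha>\<beta> D0 by (intro add_mono mult_mono) auto
  finally have \<phi>_est: "\<bar>\<phi> u - \<psi> 0 * sin (2 * \<mu> * u)\<bar> \<le> 2 * ?D * \<bar>u\<bar>" by (simp add: mult_ac)
  \<comment> \<open>For even n the second function vanishes at 0, for odd n the first. The resulting
    sign is the same \<open>(-1) ^ n\<close> that parity produces in the Christoffel-Darboux
    bracket.\<close>
  have \<psi>0: "(-1) ^ n * \<psi> 0 = ?e 0"
    using hermite_fun_minus[of n 0] hermite_fun_minus[of "Suc n" 0] by (cases "even n") (auto simp: \<psi>_def)
  have "2 * (u - - u) * hermite_kernel n u (- u) = \<mu> * (?b u * ?a (- u) - ?a u * ?b (- u))"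
    unfolding \<mu>_def by (rule Christoffel_Darboux)
  also have "\<dots> = (-1) ^ n * (\<mu> * (2 * ?a u * ?b u))"
    by (simp add: hermite_fun_minus algebra_simps)
  also have "\<mu> * (2 * ?a u * ?b u) = \<mu> * \<phi> u + u * ?e u"
    using mu by (simp add: \<phi>_def right_diff_distrib)
  finally have "4 * u * hermite_kernel n u (- u) - \<mu> * ?e 0 * sin (2 * \<mu> * u)
      = (-1) ^ n * (\<mu> * (\<phi> u - \<psi> 0 * sin (2 * \<mu> * u)) + u * ?e u)"
    unfolding \<psi>0[symmetric] by (simp add: algebra_simps)
  then have "\<bar>4 * u * hermite_kernel n u (- u) - \<mu> * ?e 0 * sin (2 * \<mu> * u)\<bar>
      = \<bar>\<mu> * (\<phi> u - \<psi> 0 * sin (2 * \<mu> * u)) + u * ?e u\<bar>"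
    by (simp add: abs_mult power_abs)
  also have "\<dots> \<le> \<mu> * \<bar>\<phi> u - \<psi> 0 * sin (2 * \<mu> * u)\<bar> + \<bar>u\<bar> * \<bar>?e u\<bar>"
    using mu by (intro order_trans[OF abs_triangle_ineq]) (simp add: abs_mult)
  also have "\<dots> \<le> \<mu> * (2 * ?D * \<bar>u\<bar>) + \<bar>u\<bar> * M"
    using \<phi>_est mu M[OF u(1)] by (intro add_mono mult_left_mono) auto
  \<comment> \<open>The factor mu cancels the 1/mu in \<open>?D\<close>, so the total is (2(1 +
    2T^2) + 1) M |u|; the final 1 stems from replacing 2ab by \<open>\<phi>\<close>.\<close>
  also have "\<dots> = 4 * \<bar>u\<bar> * ((3 / 4 + T\<^sup>2) * M)"
    using mu by (simp add: field_simps)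
  finally have *: "\<bar>4 * u * hermite_kernel n u (- u) - \<mu> * ?e 0 * sin (2 * \<mu> * u)\<bar> \<le> 4 * \<bar>u\<bar> * ((3 / 4 + T\<^sup>2) * M)" .
  have "\<bar>hermite_kernel n u (- u) - \<mu> * ?e 0 * sin (2 * \<mu> * u) / (4 * u)\<bar>
      = \<bar>4 * u * hermite_kernel n u (- u) - \<mu> * ?e 0 * sin (2 * \<mu> * u)\<bar> / (4 * \<bar>u\<bar>)"
  proof -
    have "hermite_kernel n u (- u) - \<mu> * ?e 0 * sin (2 * \<mu> * u) / (4 * u)
      = (4 * u * hermite_kernel n u (- u) - \<mu> * ?e 0 * sin (2 * \<mu> * u)) / (4 * u)"
      using u(2) by (simp add: diff_divide_distrib)
    then show ?thesis by (simp add: abs_divide abs_mult)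
  qed
  also have "\<dots> \<le> (3 / 4 + T\<^sup>2) * M"
    using * u(2) by (simp add: pos_divide_le_eq mult_ac)
  finally show ?thesis .
qed

lemma hermite_kernel_sinc:
  fixes T x y :: real
  assumes T: "1 \<le> T" "4 * T \<le> sqrt (2 * real n + 2)" and x: "\<bar>x\<bar> \<le> T" and y: "\<bar>y\<bar> \<le> T" and "x \<noteq> y"
  defines "\<mu> \<equiv> sqrt (2 * real n + 2)"
  shows "\<bar>hermite_kernel n x y - sin (\<mu> * (x - y)) / (pi * (x - y))\<bar> \<le> 7 * T\<^sup>2 / \<mu>"
proof -
  define \<rho> where "\<rho> = (hermite_fun n 0)\<^sup>2 + (hermite_fun (Suc n) 0)\<^sup>2"
  have mu4: "4 \<le> \<mu>" using T by (simp add: \<mu>_def)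
  then have mu: "\<mu> > 0" by simp
  have mu2: "\<mu>\<^sup>2 = 2 * real n + 2" by (simp add: \<mu>_def)
  have "16 \<le> \<mu>\<^sup>2" using power_mono[OF mu4, of 2] by simp
  then have n: "n \<ge> 1" using mu2 by simp
  have amp: "\<bar>\<mu> * \<rho> / 2 - 1 / pi\<bar> \<le> 1 / \<mu>\<^sup>2"
    using hermite_amplitude[OF n] unfolding mu2 by (simp add: \<mu>_def \<rho>_def)
  \<comment> \<open>An amplitude of at most 1/3 + 1/16 < 1/2 means that the energy bound
    \<open>2 * \<rho>\<close> is at most 2/mu. This is the source of the 1/mu in all error
    terms.\<close>
  have "1 / pi \<le> 1 / 3" using pi_gt3 by (intro divide_left_mono) auto
  moreover have "1 / \<mu>\<^sup>2 \<le> 1 / 16" using \<open>16 \<le> \<mu>\<^sup>2\<close> by (intro divide_left_mono) auto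
  ultimately have "\<mu> * \<rho> / 2 \<le> 1 / 2" using amp by linarith
  then have rho: "2 * \<rho> \<le> 2 / \<mu>" using mu by (simp add: field_simps)
  have M: "(hermite_fun n z)\<^sup>2 + (hermite_fun (Suc n) z)\<^sup>2 \<le> 2 * \<rho>" if "\<bar>z\<bar> \<le> T" for z
    unfolding \<rho>_def using T(2) that by (rule hermite_energy_bound)
  have "\<bar>(x - y) / 2\<bar> \<le> T" using x y by auto
  then have *: "\<bar>hermite_kernel n ((x - y) / 2) (- (x - y) / 2) - \<mu> * \<rho> * sin (\<mu> * (x - y)) / (2 * (x - y))\<bar> \<le> (3 / 4 + T\<^sup>2) * (2 * \<rho>)"
  proof -
    have e: "- ((x - y) / 2) = - (x - y) / 2" "2 * \<mu> * ((x - y) / 2) = \<mu> * (x - y)" "4 * ((x - y) / 2) = 2 * (x - y)"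
      by (rule minus_divide_left) simp_all
    have "(x - y) / 2 \<noteq> 0" using \<open>x \<noteq> y\<close> by simp
    with hermite_kernel_antidiagonal[OF M \<open>\<bar>(x - y) / 2\<bar> \<le> T\<close>] show ?thesis
      unfolding \<mu>_def[symmetric] \<rho>_def[symmetric] e by blast
  qed
  have "\<mu> * \<rho> * sin (\<mu> * (x - y)) / (2 * (x - y)) - sin (\<mu> * (x - y)) / (pi * (x - y))
      = (\<mu> * \<rho> / 2 - 1 / pi) * (sin (\<mu> * (x - y)) / (x - y))"
  proof -
    have "A * s / (2 * d) - s / (p * d) = (A / 2 - 1 / p) * (s / d)" for A s d p :: real
      by (simp add: left_diff_distrib diff_divide_distrib)
    then show ?thesis .
  qed
  \<comment> \<open>The quotient of the sine by x - y is at most mu in modulus, even near the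
    diagonal, so an amplitude error of 1/mu^2 costs only 1/mu.\<close>
  also have "\<bar>\<dots>\<bar> \<le> 1 / \<mu>\<^sup>2 * \<mu>"
    unfolding abs_mult
  proof (intro mult_mono amp)
    have "\<bar>sin (\<mu> * (x - y))\<bar> \<le> \<mu> * \<bar>x - y\<bar>"
      using abs_sin_x_le_abs_x[of "\<mu> * (x - y)"] mu by (simp add: abs_mult)
    then show "\<bar>sin (\<mu> * (x - y)) / (x - y)\<bar> \<le> \<mu>"
      using \<open>x \<noteq> y\<close> by (simp add: abs_divide pos_divide_le_eq)
  qed auto
  finally have "\<bar>\<mu> * \<rho> * sin (\<mu> * (x - y)) / (2 * (x - y)) - sin (\<mu> * (x - y)) / (pi * (x - y))\<bar> \<le> 1 / \<mu>"
    using mu by (simp add: power2_eq_square)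
  with * hermite_kernel_near_antidiagonal[OF M x y]
  have "\<bar>hermite_kernel n x y - sin (\<mu> * (x - y)) / (pi * (x - y))\<bar> \<le> (1 + T\<^sup>2) / 2 * (2 * \<rho>) + (3 / 4 + T\<^sup>2) * (2 * \<rho>) + 1 / \<mu>"
    by linarith
  also have "\<dots> = (5 / 4 + 3 / 2 * T\<^sup>2) * (2 * \<rho>) + 1 / \<mu>" by (simp add: field_simps)
  also have "\<dots> \<le> (5 / 4 + 3 / 2 * T\<^sup>2) * (2 / \<mu>) + 1 / \<mu>"
    using rho by (intro add_mono mult_left_mono) auto
  also have "\<dots> = (7 / 2 + 3 * T\<^sup>2) / \<mu>" by (simp add: add_divide_distrib distrib_right)
  \<comment> \<open>As T >= 1, the constant 7/2 is at most (7/2) T^2, and 7/2 + 3 <= 7.\<close>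
  also have "\<dots> \<le> 7 * T\<^sup>2 / \<mu>"
    using power_mono[OF T(1), of 2] mu by (intro divide_right_mono) auto
  finally show ?thesis .
qed

section \<open>Square-integrable functions and the Fourier transform\<close>

lemma square_integrableD:
  assumes "square_integrable f"
  shows "f \<in> borel_measurable borel" "integrable lborel (\<lambda>t. (cmod (f t))\<^sup>2)"
  using assms by (auto simp: square_integrable_def)

lemma square_integrable_bound:
  assumes "square_integrable f" "g \<in> borel_measurable borel" "\<And>t. cmod (g t) \<le> cmod (f t)"
  shows "square_integrable g"
  unfolding square_integrable_def
proof
  show "integrable lborel (\<lambda>t. (cmod (g t))\<^sup>2)"
    by (rule Bochner_Integration.integrable_bound[OF square_integrableD(2)[OF assms(1)]])
       (use assms(2,3) in \<open>auto intro!: power_mono\<close>)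
qed (use assms(2) in simp)

lemma integrable_cmod_mult:
  assumes "square_integrable f" "square_integrable g"
  shows "integrable lborel (\<lambda>t. cmod (f t) * cmod (g t))"
proof (rule Bochner_Integration.integrable_bound)
  note [measurable] = assms[THEN square_integrableD(1)]
  show "integrable lborel (\<lambda>t. (cmod (f t))\<^sup>2 + (cmod (g t))\<^sup>2)"
    using assms[THEN square_integrableD(2)] by simp
  show "(\<lambda>t. cmod (f t) * cmod (g t)) \<in> borel_measurable lborel" by measurable
  show "AE t in lborel. norm (cmod (f t) * cmod (g t)) \<le> norm ((cmod (f t))\<^sup>2 + (cmod (g t))\<^sup>2)"
  proof (rule AE_I2)
    fix t
    show "norm (cmod (f t) * cmod (g t)) \<le> norm ((cmod (f t))\<^sup>2 + (cmod (g t))\<^sup>2)"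
      using sum_squares_bound[of "cmod (f t)" "cmod (g t)"] mult_nonneg_nonneg[of "cmod (f t)" "cmod (g t)"]
      unfolding real_norm_def by (simp del: mult_nonneg_nonneg)
  qed
qed

lemma integrable_mult_cnj:
  assumes "square_integrable f" "square_integrable g"
  shows "integrable lborel (\<lambda>t. f t * cnj (g t))"
proof (rule Bochner_Integration.integrable_bound[OF integrable_cmod_mult[OF assms]])
  note [measurable] = assms[THEN square_integrableD(1)]
  have "(\<lambda>t. cnj (g t)) \<in> borel_measurable borel"
    by (rule borel_measurable_continuous_on[OF continuous_on_cnj[OF continuous_on_id]]) measurable
  then show "(\<lambda>t. f t * cnj (g t)) \<in> borel_measurable lborel" by simp
qed (simp add: norm_mult)

lemma square_integrable_diff:
  assumes "square_integrable f" "square_integrable g"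
  shows "square_integrable (\<lambda>t. f t - g t)"
  unfolding square_integrable_def
proof
  note [measurable] = assms[THEN square_integrableD(1)]
  show "(\<lambda>t. f t - g t) \<in> borel_measurable lborel" by measurable
  show "integrable lborel (\<lambda>t. (cmod (f t - g t))\<^sup>2)"
  proof (rule Bochner_Integration.integrable_bound)
    show "integrable lborel (\<lambda>t. 2 * (cmod (f t))\<^sup>2 + 2 * (cmod (g t))\<^sup>2)"
      using assms[THEN square_integrableD(2)] by simp
    show "(\<lambda>t. (cmod (f t - g t))\<^sup>2) \<in> borel_measurable lborel" by measurable
    show "AE t in lborel. norm ((cmod (f t - g t))\<^sup>2) \<le> norm (2 * (cmod (f t))\<^sup>2 + 2 * (cmod (g t))\<^sup>2)"
    proof (rule AE_I2)
      fix t
      have "(cmod (f t - g t))\<^sup>2 \<le> (cmod (f t) + cmod (g t))\<^sup>2"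
        by (intro power_mono norm_triangle_ineq4) simp
      also have "\<dots> \<le> 2 * (cmod (f t))\<^sup>2 + 2 * (cmod (g t))\<^sup>2"
        using sum_squares_bound[of "cmod (f t)" "cmod (g t)"] by (simp add: power2_sum)
      finally show "norm ((cmod (f t - g t))\<^sup>2) \<le> norm (2 * (cmod (f t))\<^sup>2 + 2 * (cmod (g t))\<^sup>2)" by simp
    qed
  qed
qed

lemma square_integrable_restrict:
  assumes "square_integrable f" "S \<in> sets borel"
  shows "square_integrable (\<lambda>t. indicator S t *\<^sub>R f t)"
proof (rule square_integrable_bound[OF assms(1)])
  note [measurable] = assms(2) square_integrableD(1)[OF assms(1)]
  show "(\<lambda>t. indicator S t *\<^sub>R f t) \<in> borel_measurable borel" by measurable
qed (auto simp: indicator_def)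

lemma L2_norm_nonneg: "0 \<le> L2_norm_R f"
  by (simp add: L2_norm_R_def)

lemma L2_norm_power2: "(L2_norm_R f)\<^sup>2 = (LINT t|lborel. (cmod (f t))\<^sup>2)"
  by (simp add: L2_norm_R_def)

lemma L2_norm_restrict_le:
  assumes "square_integrable f" "S \<in> sets borel"
  shows "L2_norm_R (\<lambda>t. indicator S t *\<^sub>R f t) \<le> L2_norm_R f"
  unfolding L2_norm_R_def
  by (intro real_sqrt_le_mono integral_mono square_integrableD(2) square_integrable_restrict assms)
     (auto simp: indicator_def)

lemma Cauchy_Schwarz_cmod:
  assumes "square_integrable f" "square_integrable g"
  shows "(LINT t|lborel. cmod (f t) * cmod (g t)) \<le> L2_norm_R f * L2_norm_R g"
proof -
  let ?I = "LINT t|lborel. cmod (f t) * cmod (g t)"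
  note [measurable] = assms[THEN square_integrableD(1)]
  have I0: "0 \<le> ?I" by (intro integral_nonneg_AE AE_I2) simp
  have "(\<integral>\<^sup>+ t. ennreal (cmod (f t)) * ennreal (cmod (g t)) \<partial>lborel)\<^sup>2
     \<le> (\<integral>\<^sup>+ t. (ennreal (cmod (f t)))\<^sup>2 \<partial>lborel) * (\<integral>\<^sup>+ t. (ennreal (cmod (g t)))\<^sup>2 \<partial>lborel)"
    by (rule Cauchy_Schwarz_nn_integral) auto
  also have "(\<integral>\<^sup>+ t. (ennreal (cmod (f t)))\<^sup>2 \<partial>lborel) = ennreal ((L2_norm_R f)\<^sup>2)"
    unfolding L2_norm_power2 using nn_integral_eq_integral[OF square_integrableD(2)[OF assms(1)]]
    by (simp add: ennreal_power)
  also have "(\<integral>\<^sup>+ t. (ennreal (cmod (g t)))\<^sup>2 \<partial>lborel) = ennreal ((L2_norm_R g)\<^sup>2)"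
    unfolding L2_norm_power2 using nn_integral_eq_integral[OF square_integrableD(2)[OF assms(2)]]
    by (simp add: ennreal_power)
  also have "(\<integral>\<^sup>+ t. ennreal (cmod (f t)) * ennreal (cmod (g t)) \<partial>lborel) = ennreal ?I"
    using nn_integral_eq_integral[OF integrable_cmod_mult[OF assms]] by (simp add: ennreal_mult)
  finally have "?I\<^sup>2 \<le> (L2_norm_R f)\<^sup>2 * (L2_norm_R g)\<^sup>2"
    using I0 by (simp add: ennreal_power ennreal_mult[symmetric])
  then have "?I\<^sup>2 \<le> (L2_norm_R f * L2_norm_R g)\<^sup>2"
    by (simp add: power_mult_distrib)
  then show ?thesis
    by (rule power2_le_imp_le) (simp add: L2_norm_nonneg)
qed

lemma Cauchy_Schwarz_L2:
  assumes "square_integrable f" "square_integrable g"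
  shows "cmod (L2_inner f g) \<le> L2_norm_R f * L2_norm_R g"
  unfolding L2_inner_def
  by (rule order_trans[OF integral_norm_bound]) (simp add: norm_mult Cauchy_Schwarz_cmod assms)

text \<open>Cauchy-Schwarz against the indicator of the support, whose norm is sqrt(2R). Applied to
  both arguments of the kernel form, it contributes the factor 2T that raises T^2 to T^3.\<close>

lemma compact_support_integrable:
  assumes "square_integrable u" "\<And>t. t \<notin> {-R..R} \<Longrightarrow> u t = 0" "0 \<le> R"
  shows "integrable lborel u" "(LINT t|lborel. cmod (u t)) \<le> sqrt (2 * R) * L2_norm_R u"
proof -
  note [measurable] = square_integrableD(1)[OF assms(1)]
  have i: "integrable lborel (indicat_real {-R..R})" by (rule integrable_real_indicator) (simp_all add: emeasure_lborel_Icc_eq)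
  have p: "(cmod (complex_of_real (indicat_real {-R..R} t)))\<^sup>2 = indicat_real {-R..R} t" for t
    by (simp add: indicator_def)
  have s: "square_integrable (\<lambda>t. complex_of_real (indicat_real {-R..R} t))"
    unfolding square_integrable_def p using i by simp
  have e: "cmod (u t) = cmod (u t) * cmod (complex_of_real (indicat_real {-R..R} t))" for t
    using assms(2)[of t] by (auto simp: indicator_def)
  have "integrable lborel (\<lambda>t. cmod (u t))"
    by (subst e) (rule integrable_cmod_mult[OF assms(1) s])
  then show "integrable lborel u" by (rule integrable_norm_cancel) simp
  have "L2_norm_R (\<lambda>t. complex_of_real (indicat_real {-R..R} t)) = sqrt (2 * R)"
    unfolding L2_norm_R_def p using assms(3) by simp
  with Cauchy_Schwarz_cmod[OF assms(1) s] show "(LINT t|lborel. cmod (u t)) \<le> sqrt (2 * R) * L2_norm_R u"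
    by (subst e) (simp add: mult.commute)
qed

section \<open>The pointwise Fourier transform and weighted Parseval identities\<close>

definition fourier :: "(real \<Rightarrow> complex) \<Rightarrow> real \<Rightarrow> complex" where
  "fourier u \<omega> = complex_of_real (1 / sqrt (2 * pi)) * (LINT t|lborel. u t * cis (- (t * \<omega>)))"

lemma measurable_cis [measurable]: "cis \<in> borel_measurable borel"
  by (intro borel_measurable_continuous_onI continuous_on_cis continuous_on_id)

lemma measurable_cnj [measurable]: "cnj \<in> borel_measurable borel"
  by (intro borel_measurable_continuous_onI continuous_on_cnj continuous_on_id)

lemma integrable_mult_cis:
  assumes "integrable lborel u" "g \<in> borel_measurable borel"
  shows "integrable lborel (\<lambda>t. u t * cis (g t))"
  by (rule Bochner_Integration.integrable_bound[OF assms(1)])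
     (use assms in \<open>auto simp: norm_mult intro!: measurable_compose[OF _ measurable_cis]\<close>)

lemma measurable_fourier [measurable]:
  assumes [measurable]: "u \<in> borel_measurable borel"
  shows "fourier u \<in> borel_measurable borel"
  unfolding fourier_def by measurable

lemma fourier_diff:
  assumes "integrable lborel u" "integrable lborel v"
  shows "fourier (\<lambda>t. u t - v t) \<omega> = fourier u \<omega> - fourier v \<omega>"
proof -
  have "integrable lborel (\<lambda>t. u t * cis (- (t * \<omega>)))" "integrable lborel (\<lambda>t. v t * cis (- (t * \<omega>)))"
    using assms by (auto intro!: integrable_mult_cis)
  then show ?thesis by (simp add: fourier_def left_diff_distrib right_diff_distrib)
qed

lemma cmod_fourier_le:
  "cmod (fourier u \<omega>) \<le> 1 / sqrt (2 * pi) * (LINT t|lborel. cmod (u t))"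
proof -
  have "cmod (fourier u \<omega>) = 1 / sqrt (2 * pi) * cmod (LINT t|lborel. u t * cis (- (t * \<omega>)))"
    by (simp add: fourier_def norm_mult norm_divide)
  also have "\<dots> \<le> 1 / sqrt (2 * pi) * (LINT t|lborel. cmod (u t * cis (- (t * \<omega>))))"
    by (intro mult_left_mono integral_norm_bound) simp
  finally show ?thesis by (simp add: norm_mult)
qed

lemma integrable_mult_bounded:
  fixes e h :: "real \<Rightarrow> complex"
  assumes "integrable lborel e" "h \<in> borel_measurable borel" "\<And>t. cmod (h t) \<le> C"
  shows "integrable lborel (\<lambda>t. e t * h t)"
proof (rule Bochner_Integration.integrable_bound)
  show "integrable lborel (\<lambda>t. complex_of_real C * e t)" using assms(1) by simp
  show "(\<lambda>t. e t * h t) \<in> borel_measurable lborel" using assms(1,2) by simp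
  show "AE t in lborel. norm (e t * h t) \<le> norm (complex_of_real C * e t)"
  proof (rule AE_I2)
    fix t
    have "0 \<le> C" using assms(3)[of t] norm_ge_zero order_trans by blast
    then show "norm (e t * h t) \<le> norm (complex_of_real C * e t)"
      using mult_left_mono[OF assms(3)[of t], of "cmod (e t)"] by (simp add: norm_mult mult.commute)
  qed
qed

text \<open>The parameter s lets one Fubini argument serve both the transform (s = -1) and its
  conjugate (s = 1).\<close>

lemma fourier_swap:
  fixes u v :: "real \<Rightarrow> complex"
  assumes "integrable lborel u" "integrable lborel v"
  shows "(LINT \<omega>|lborel. v \<omega> * (LINT t|lborel. u t * cis (s * (t * \<omega>)))) = (LINT t|lborel. u t * (LINT \<omega>|lborel. v \<omega> * cis (s * (t * \<omega>))))"
proof -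
  note [measurable] = borel_measurable_integrable[OF assms(1)] borel_measurable_integrable[OF assms(2)]
  have "integrable (lborel \<Otimes>\<^sub>M lborel) (\<lambda>p. v (fst p) * u (snd p))"
    by (rule lborel_pair.Fubini_integrable) (use assms in \<open>auto simp: norm_mult\<close>)
  then have "integrable (lborel \<Otimes>\<^sub>M lborel) (\<lambda>p. (v (fst p) * u (snd p)) * cis (s * (snd p * fst p)))"
    by (rule Bochner_Integration.integrable_bound) (auto simp: norm_mult)
  then have "integrable (lborel \<Otimes>\<^sub>M lborel) (\<lambda>(\<omega>, t). v \<omega> * (u t * cis (s * (t * \<omega>))))"
    by (simp add: case_prod_unfold mult.assoc)
  note swap = lborel_pair.Fubini_integral[OF this]
  have "(LINT \<omega>|lborel. v \<omega> * (LINT t|lborel. u t * cis (s * (t * \<omega>)))) = (LINT \<omega>|lborel. LINT t|lborel. v \<omega> * (u t * cis (s * (t * \<omega>))))"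
    using assms(1) by (intro Bochner_Integration.integral_cong refl integral_mult_right[symmetric] integrable_mult_cis) auto
  also have "\<dots> = (LINT t|lborel. LINT \<omega>|lborel. u t * (v \<omega> * cis (s * (t * \<omega>))))"
    by (subst swap[symmetric]) (simp only: mult.left_commute)
  also have "\<dots> = (LINT t|lborel. u t * (LINT \<omega>|lborel. v \<omega> * cis (s * (t * \<omega>))))"
    using assms(2) by (intro Bochner_Integration.integral_cong refl integral_mult_right integrable_mult_cis) auto
  finally show ?thesis .
qed

text \<open>Transforms of integrable functions are bounded but need not be integrable, so the
  integrable weight \<open>e\<close> is what legitimates the two exchanges of integrals. A Gaussian
  weight will lead to Parseval's identity, the indicator of a frequency band to the sinc
  kernel.\<close>

lemma fourier_weighted_parseval:
  fixes e u g :: "real \<Rightarrow> complex"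
  assumes e: "integrable lborel e" and u: "integrable lborel u" and g: "integrable lborel g"
  shows "(LINT \<omega>|lborel. e \<omega> * (fourier u \<omega> * cnj (fourier g \<omega>)))
    = 1 / (2 * pi) * (LINT y|lborel. u y * (LINT x|lborel. cnj (g x) * (LINT \<omega>|lborel. e \<omega> * cis (\<omega> * (x - y)))))"
proof -
  define c where "c = complex_of_real (1 / sqrt (2 * pi))"
  have cc: "c * c = 1 / (2 * pi)"
    by (simp add: c_def flip: of_real_mult)
  note [measurable] = borel_measurable_integrable[OF e] borel_measurable_integrable[OF u] borel_measurable_integrable[OF g]
  define v where "v = (\<lambda>\<omega>. e \<omega> * cnj (fourier g \<omega>))"
  have v: "integrable lborel v"
    unfolding v_def
    by (rule integrable_mult_bounded[OF e, where C = "1 / sqrt (2 * pi) * (LINT t|lborel. cmod (g t))"])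
       (simp_all only: complex_mod_cnj cmod_fourier_le, measurable)
  have inner: "(LINT \<omega>|lborel. v \<omega> * cis (- (y * \<omega>))) = c * (LINT x|lborel. cnj (g x) * (LINT \<omega>|lborel. e \<omega> * cis (\<omega> * (x - y))))" for y
  proof -
    have "cnj (fourier g \<omega>) = c * (LINT x|lborel. cnj (g x) * cis (1 * (x * \<omega>)))" for \<omega>
    proof -
      have "cnj (LINT x|lborel. g x * cis (- (x * \<omega>))) = (LINT x|lborel. cnj (g x * cis (- (x * \<omega>))))"
        by (rule Bochner_Integration.integral_cnj[symmetric])
      then show ?thesis by (simp add: fourier_def c_def cis_cnj)
    qed
    then have "(LINT \<omega>|lborel. v \<omega> * cis (- (y * \<omega>)))
        = (LINT \<omega>|lborel. c * ((e \<omega> * cis (- (y * \<omega>))) * (LINT x|lborel. cnj (g x) * cis (1 * (x * \<omega>)))))"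
      unfolding v_def by (intro Bochner_Integration.integral_cong refl) (simp add: mult_ac)
    also have "\<dots> = c * (LINT \<omega>|lborel. (e \<omega> * cis (- (y * \<omega>))) * (LINT x|lborel. cnj (g x) * cis (1 * (x * \<omega>))))"
      by simp
    also have "(LINT \<omega>|lborel. (e \<omega> * cis (- (y * \<omega>))) * (LINT x|lborel. cnj (g x) * cis (1 * (x * \<omega>))))
        = (LINT x|lborel. cnj (g x) * (LINT \<omega>|lborel. (e \<omega> * cis (- (y * \<omega>))) * cis (1 * (x * \<omega>))))"
      using e g by (intro fourier_swap integrable_mult_cis) simp_all
    also have "(\<lambda>x \<omega>. (e \<omega> * cis (- (y * \<omega>))) * cis (1 * (x * \<omega>))) = (\<lambda>x \<omega>. e \<omega> * cis (\<omega> * (x - y)))"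
      by (auto simp: fun_eq_iff mult.assoc cis_mult algebra_simps)
    finally show ?thesis by (simp add: fun_eq_iff)
  qed
  have "(LINT \<omega>|lborel. e \<omega> * (fourier u \<omega> * cnj (fourier g \<omega>)))
      = (LINT \<omega>|lborel. c * (v \<omega> * (LINT t|lborel. u t * cis ((-1) * (t * \<omega>)))))"
    by (intro Bochner_Integration.integral_cong refl) (simp add: v_def fourier_def c_def mult_ac)
  also have "\<dots> = c * (LINT \<omega>|lborel. v \<omega> * (LINT t|lborel. u t * cis ((-1) * (t * \<omega>))))"
    by simp
  also have "(LINT \<omega>|lborel. v \<omega> * (LINT t|lborel. u t * cis ((-1) * (t * \<omega>))))
      = (LINT t|lborel. u t * (LINT \<omega>|lborel. v \<omega> * cis ((-1) * (t * \<omega>))))"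
    by (rule fourier_swap[OF u v])
  also have "\<dots> = (LINT t|lborel. c * (u t * (LINT x|lborel. cnj (g x) * (LINT \<omega>|lborel. e \<omega> * cis (\<omega> * (x - t))))))"
    by (intro Bochner_Integration.integral_cong refl) (simp add: inner)
  also have "\<dots> = c * (LINT t|lborel. (u t * (LINT x|lborel. cnj (g x) * (LINT \<omega>|lborel. e \<omega> * cis (\<omega> * (x - t))))))"
    by simp
  finally show ?thesis by (simp add: cc flip: mult.assoc)
qed

text \<open>Read off from the characteristic function of the standard normal distribution by
  rescaling. As \<sigma> tends to 0 the weight tends to 1 while its transform concentrates at
  0.\<close>

lemma integral_gauss_cis:
  assumes "\<sigma> > 0"
  shows "integrable lborel (\<lambda>\<omega>. complex_of_real (exp (- (\<sigma> * \<omega>)\<^sup>2 / 2)))"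
    and "(LINT \<omega>|lborel. complex_of_real (exp (- (\<sigma> * \<omega>)\<^sup>2 / 2)) * cis (\<omega> * d)) = of_real (2 * pi * normal_density 0 \<sigma> d)"
proof -
  have e: "exp (- (\<sigma> * \<omega>)\<^sup>2 / 2) = sqrt (2 * pi) * std_normal_density (0 + \<sigma> * \<omega>)" for \<omega>
    by (simp add: normal_density_def)
  have "integrable lborel (\<lambda>\<omega>. std_normal_density (0 + \<sigma> * \<omega>))"
    using assms by (intro lborel_integrable_real_affine integrable_normal_density) simp_all
  then show "integrable lborel (\<lambda>\<omega>. complex_of_real (exp (- (\<sigma> * \<omega>)\<^sup>2 / 2)))"
    unfolding e by (intro integrable_of_real integrable_mult_right)
  have "char std_normal_distribution (d / \<sigma>) = (LINT x|lborel. std_normal_density x *\<^sub>R cis ((d / \<sigma>) * x))"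
    unfolding char_def by (subst integral_density) (auto simp: normal_density_nonneg cis_conv_exp mult_ac)
  also have "\<dots> = \<bar>\<sigma>\<bar> *\<^sub>R (LINT \<omega>|lborel. std_normal_density (0 + \<sigma> * \<omega>) *\<^sub>R cis ((d / \<sigma>) * (0 + \<sigma> * \<omega>)))"
    using assms by (intro lborel_integral_real_affine) simp
  also have "(\<lambda>\<omega>. std_normal_density (0 + \<sigma> * \<omega>) *\<^sub>R cis ((d / \<sigma>) * (0 + \<sigma> * \<omega>)))
      = (\<lambda>\<omega>. (1 / sqrt (2 * pi)) *\<^sub>R (complex_of_real (exp (- (\<sigma> * \<omega>)\<^sup>2 / 2)) * cis (\<omega> * d)))"
    unfolding e using assms by (auto simp: fun_eq_iff scaleR_conv_of_real mult_ac real_sqrt_mult)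
  finally have "of_real (exp (- (d / \<sigma>)\<^sup>2 / 2)) = (\<sigma> / sqrt (2 * pi)) *\<^sub>R (LINT \<omega>|lborel. complex_of_real (exp (- (\<sigma> * \<omega>)\<^sup>2 / 2)) * cis (\<omega> * d))"
    using assms by (simp add: char_std_normal_distribution)
  then have "(LINT \<omega>|lborel. complex_of_real (exp (- (\<sigma> * \<omega>)\<^sup>2 / 2)) * cis (\<omega> * d)) = (sqrt (2 * pi) / \<sigma>) *\<^sub>R of_real (exp (- (d / \<sigma>)\<^sup>2 / 2))"
    using assms by simp
  also have "\<dots> = of_real (sqrt (2 * pi) / \<sigma> * exp (- (d / \<sigma>)\<^sup>2 / 2))"
    by (simp only: scaleR_conv_of_real of_real_mult)
  also have "sqrt (2 * pi) / \<sigma> * exp (- (d / \<sigma>)\<^sup>2 / 2) = 2 * pi * normal_density 0 \<sigma> d"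
  proof -
    have "2 * pi = sqrt (2 * pi) * sqrt (2 * pi)" by simp
    then show ?thesis
      using assms by (simp add: normal_density_def real_sqrt_mult power_divide field_simps)
  qed
  finally show "(LINT \<omega>|lborel. complex_of_real (exp (- (\<sigma> * \<omega>)\<^sup>2 / 2)) * cis (\<omega> * d)) = of_real (2 * pi * normal_density 0 \<sigma> d)" .
qed

lemma fourier_gauss_parseval:
  assumes "\<sigma> > 0" "integrable lborel u" "integrable lborel g"
  shows "(LINT \<omega>|lborel. of_real (exp (- (\<sigma> * \<omega>)\<^sup>2 / 2)) * (fourier u \<omega> * cnj (fourier g \<omega>)))
    = (LINT y|lborel. u y * (LINT x|lborel. cnj (g x) * of_real (normal_density 0 \<sigma> (x - y))))"
proof -
  have "(LINT y|lborel. u y * (LINT x|lborel. cnj (g x) * complex_of_real (2 * pi * normal_density 0 \<sigma> (x - y))))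
     = (LINT y|lborel. (2 * pi) * (u y * (LINT x|lborel. cnj (g x) * complex_of_real (normal_density 0 \<sigma> (x - y)))))"
  proof (intro Bochner_Integration.integral_cong refl)
    fix y
    have "(LINT x|lborel. cnj (g x) * complex_of_real (2 * pi * normal_density 0 \<sigma> (x - y)))
       = (LINT x|lborel. complex_of_real (2 * pi) * (cnj (g x) * complex_of_real (normal_density 0 \<sigma> (x - y))))"
      by (intro Bochner_Integration.integral_cong refl) simp
    then show "u y * (LINT x|lborel. cnj (g x) * complex_of_real (2 * pi * normal_density 0 \<sigma> (x - y)))
       = (2 * pi) * (u y * (LINT x|lborel. cnj (g x) * complex_of_real (normal_density 0 \<sigma> (x - y))))"
      by simp
  qed
  then show ?thesis
    unfolding fourier_weighted_parseval[OF integral_gauss_cis(1)[OF assms(1)] assms(2,3)] integral_gauss_cis(2)[OF assms(1)]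
    by (simp del: of_real_mult)
qed

section \<open>Parseval's identity for compactly supported functions\<close>

text \<open>Integrability need not be assumed because the Bochner integral of a non-integrable
  function is 0 by default. Iterated integrals can thus be estimated before their integrability is
  discussed.\<close>

lemma norm_integral_le_nn_integral:
  fixes f :: "'a \<Rightarrow> 'b::{banach, second_countable_topology}"
  shows "ennreal (norm (integral\<^sup>L M f)) \<le> (\<integral>\<^sup>+ x. ennreal (norm (f x)) \<partial>M)"
  by (cases "integrable M f") (auto intro: integral_norm_bound_ennreal simp: not_integrable_integral_eq)

lemma nn_integral_gauss_shift:
  assumes "\<sigma> > 0"
  shows "(\<integral>\<^sup>+ x. ennreal (normal_density 0 \<sigma> (x - y)) \<partial>lborel) = 1"
    and "(\<integral>\<^sup>+ y. ennreal (normal_density 0 \<sigma> (x - y)) \<partial>lborel) = 1"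
proof -
  have 1: "(\<integral>\<^sup>+ x. ennreal (normal_density y \<sigma> x) \<partial>lborel) = 1" for y
    using nn_integral_eq_integral[OF integrable_normal_density[OF assms]] integral_normal_density[OF assms]
    by (simp add: normal_density_nonneg)
  have 2: "normal_density 0 \<sigma> (x - y) = normal_density y \<sigma> x" "normal_density 0 \<sigma> (x - y) = normal_density x \<sigma> y" for x y
    by (simp_all add: normal_density_def power2_commute)
  show "(\<integral>\<^sup>+ x. ennreal (normal_density 0 \<sigma> (x - y)) \<partial>lborel) = 1"
    unfolding 2(1) by (rule 1)
  show "(\<integral>\<^sup>+ y. ennreal (normal_density 0 \<sigma> (x - y)) \<partial>lborel) = 1"
    unfolding 2(2) by (rule 1)
qed

text \<open>Schur's test: the product of the two values of u is at most the mean of their squares,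
  and the Gaussian kernel has mass 1 in each variable separately, so each half contributes half of
  the squared norm.\<close>

lemma gauss_quadratic_form_le:
  assumes "\<sigma> > 0" and u: "square_integrable u"
  shows "cmod (LINT y|lborel. u y * (LINT x|lborel. cnj (u x) * of_real (normal_density 0 \<sigma> (x - y)))) \<le> (L2_norm_R u)\<^sup>2"
proof -
  note [measurable] = square_integrableD(1)[OF u]
  let ?G = "\<lambda>x y. normal_density 0 \<sigma> (x - y)"
  have [measurable]: "(\<lambda>p. normal_density 0 \<sigma> (fst p - snd p)) \<in> borel_measurable (borel \<Otimes>\<^sub>M borel)"
    by measurable
  have N: "(\<integral>\<^sup>+ x. ennreal ((cmod (u x))\<^sup>2) \<partial>lborel) = ennreal ((L2_norm_R u)\<^sup>2)"
    unfolding L2_norm_power2 by (rule nn_integral_eq_integral[OF square_integrableD(2)[OF u]]) simp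
  have "ennreal (cmod (LINT y|lborel. u y * (LINT x|lborel. cnj (u x) * of_real (?G x y))))
    \<le> (\<integral>\<^sup>+ y. ennreal (cmod (u y * (LINT x|lborel. cnj (u x) * of_real (?G x y)))) \<partial>lborel)"
    by (rule norm_integral_le_nn_integral)
  also have "\<dots> = (\<integral>\<^sup>+ y. ennreal (cmod (u y)) * ennreal (cmod (LINT x|lborel. cnj (u x) * of_real (?G x y))) \<partial>lborel)"
    by (simp add: norm_mult ennreal_mult)
  also have "\<dots> \<le> (\<integral>\<^sup>+ y. ennreal (cmod (u y)) * (\<integral>\<^sup>+ x. ennreal (cmod (cnj (u x) * of_real (?G x y))) \<partial>lborel) \<partial>lborel)"
    by (intro nn_integral_mono mult_left_mono norm_integral_le_nn_integral) simp
  also have "\<dots> = (\<integral>\<^sup>+ y. (\<integral>\<^sup>+ x. ennreal (cmod (u y)) * ennreal (cmod (u x) * ?G x y) \<partial>lborel) \<partial>lborel)"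
    by (intro nn_integral_cong, subst nn_integral_cmult[symmetric]) (auto simp: norm_mult)
  also have "\<dots> \<le> (\<integral>\<^sup>+ y. (\<integral>\<^sup>+ x. ennreal ((cmod (u y))\<^sup>2 / 2) * ennreal (?G x y) + ennreal ((cmod (u x))\<^sup>2 / 2) * ennreal (?G x y) \<partial>lborel) \<partial>lborel)"
  proof (intro nn_integral_mono)
    fix x y
    have "cmod (u y) * (cmod (u x) * ?G x y) = (cmod (u y) * cmod (u x)) * ?G x y" by simp
    also have "\<dots> \<le> ((cmod (u y))\<^sup>2 / 2 + (cmod (u x))\<^sup>2 / 2) * ?G x y"
      using sum_squares_bound[of "cmod (u y)" "cmod (u x)"] by (intro mult_right_mono normal_density_nonneg) simp
    finally show "ennreal (cmod (u y)) * ennreal (cmod (u x) * ?G x y)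
       \<le> ennreal ((cmod (u y))\<^sup>2 / 2) * ennreal (?G x y) + ennreal ((cmod (u x))\<^sup>2 / 2) * ennreal (?G x y)"
      by (simp add: distrib_right normal_density_nonneg flip: ennreal_mult ennreal_plus)
  qed
  also have "\<dots> = (\<integral>\<^sup>+ y. ennreal ((cmod (u y))\<^sup>2 / 2) \<partial>lborel)
      + (\<integral>\<^sup>+ y. (\<integral>\<^sup>+ x. ennreal ((cmod (u x))\<^sup>2 / 2) * ennreal (?G x y) \<partial>lborel) \<partial>lborel)"
    by (simp add: nn_integral_add nn_integral_cmult nn_integral_gauss_shift[OF assms(1)])
  also have "(\<integral>\<^sup>+ y. (\<integral>\<^sup>+ x. ennreal ((cmod (u x))\<^sup>2 / 2) * ennreal (?G x y) \<partial>lborel) \<partial>lborel)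
      = (\<integral>\<^sup>+ x. (\<integral>\<^sup>+ y. ennreal ((cmod (u x))\<^sup>2 / 2) * ennreal (?G x y) \<partial>lborel) \<partial>lborel)"
    by (rule lborel_pair.Fubini') simp
  also have "\<dots> = (\<integral>\<^sup>+ x. ennreal ((cmod (u x))\<^sup>2 / 2) \<partial>lborel)"
    by (simp add: nn_integral_cmult nn_integral_gauss_shift[OF assms(1)])
  also have "(\<integral>\<^sup>+ x. ennreal ((cmod (u x))\<^sup>2 / 2) \<partial>lborel) + (\<integral>\<^sup>+ x. ennreal ((cmod (u x))\<^sup>2 / 2) \<partial>lborel)
      = (\<integral>\<^sup>+ x. ennreal ((cmod (u x))\<^sup>2) \<partial>lborel)"
    by (subst nn_integral_add[symmetric]) (auto simp flip: ennreal_plus)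
  finally show ?thesis unfolding N by simp
qed

text \<open>Bounded support makes a square-integrable function integrable, so its transform is a
  genuine integral at every frequency and no limit in the mean is involved.\<close>

definition L2_supp :: "real \<Rightarrow> (real \<Rightarrow> complex) \<Rightarrow> bool" where
  "L2_supp R u \<longleftrightarrow> square_integrable u \<and> 0 \<le> R \<and> (\<forall>t. t \<notin> {-R..R} \<longrightarrow> u t = 0)"

lemma L2_suppD:
  assumes "L2_supp R u"
  shows "square_integrable u" "u \<in> borel_measurable borel" "integrable lborel u" "t \<notin> {-R..R} \<Longrightarrow> u t = 0"
    "(LINT t|lborel. cmod (u t)) \<le> sqrt (2 * R) * L2_norm_R u"
  using assms compact_support_integrable[of u R] square_integrableD(1)[of u] by (auto simp: L2_supp_def)

lemma L2_supp_diff: "L2_supp R u \<Longrightarrow> L2_supp R v \<Longrightarrow> L2_supp R (\<lambda>t. u t - v t)"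
  by (simp add: L2_supp_def square_integrable_diff)

lemma gauss_scale_tendsto: "(\<lambda>k. exp (- (1 / real (Suc k) * \<omega>)\<^sup>2 / 2)) \<longlonglongrightarrow> 1"
proof -
  have "(\<lambda>k. exp (- (inverse (real (Suc k)) * \<omega>)\<^sup>2 / 2)) \<longlonglongrightarrow> exp (- (0 * \<omega>)\<^sup>2 / 2)"
    by (intro tendsto_intros LIMSEQ_inverse_real_of_nat) simp
  then show ?thesis by (simp add: inverse_eq_divide)
qed

text \<open>Fatou's lemma as the Gaussian weight increases to 1: the regularized integrals of the
  squared transform are bounded by Schur's test. Only contractivity results here, but that is what
  makes the later approximation arguments stable.\<close>

lemma fourier_L2:
  assumes "L2_supp R u"
  shows "square_integrable (fourier u)" "L2_norm_R (fourier u) \<le> L2_norm_R u"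
proof -
  note [measurable] = L2_suppD(2)[OF assms]
  note ui = L2_suppD(3)[OF assms]
  let ?e = "\<lambda>k \<omega>. exp (- (1 / real (Suc k) * \<omega>)\<^sup>2 / 2)"
  have le: "(\<integral>\<^sup>+ \<omega>. ennreal (?e k \<omega> * (cmod (fourier u \<omega>))\<^sup>2) \<partial>lborel) \<le> ennreal ((L2_norm_R u)\<^sup>2)" for k
  proof -
    have ei: "integrable lborel (\<lambda>\<omega>. complex_of_real (?e k \<omega>))"
      by (rule integral_gauss_cis(1)) simp
    have eq: "complex_of_real (?e k \<omega>) * (fourier u \<omega> * cnj (fourier u \<omega>)) = of_real (?e k \<omega> * (cmod (fourier u \<omega>))\<^sup>2)" for \<omega>
      by (simp only: complex_norm_square of_real_mult)
    have "integrable lborel (\<lambda>\<omega>. complex_of_real (?e k \<omega>) * (fourier u \<omega> * cnj (fourier u \<omega>)))"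
      by (rule integrable_mult_bounded[OF ei, where C = "(1 / sqrt (2 * pi) * (LINT t|lborel. cmod (u t)))\<^sup>2"])
         (simp, auto simp only: norm_mult complex_mod_cnj power2_eq_square intro!: mult_mono' cmod_fourier_le norm_ge_zero)
    then have i: "integrable lborel (\<lambda>\<omega>. ?e k \<omega> * (cmod (fourier u \<omega>))\<^sup>2)"
      unfolding eq by (simp only: complex_of_real_integrable_eq)
    have "(LINT \<omega>|lborel. complex_of_real (?e k \<omega>) * (fourier u \<omega> * cnj (fourier u \<omega>))) = of_real (LINT \<omega>|lborel. ?e k \<omega> * (cmod (fourier u \<omega>))\<^sup>2)"
      unfolding eq by (rule integral_complex_of_real)
    then have "\<bar>LINT \<omega>|lborel. ?e k \<omega> * (cmod (fourier u \<omega>))\<^sup>2\<bar> = cmod (LINT \<omega>|lborel. complex_of_real (?e k \<omega>) * (fourier u \<omega> * cnj (fourier u \<omega>)))"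
      by (simp only: norm_of_real)
    also have "\<dots> \<le> (L2_norm_R u)\<^sup>2"
      by (subst fourier_gauss_parseval[OF _ ui ui]) (simp, intro gauss_quadratic_form_le L2_suppD(1)[OF assms], simp)
    finally have "(LINT \<omega>|lborel. ?e k \<omega> * (cmod (fourier u \<omega>))\<^sup>2) \<le> (L2_norm_R u)\<^sup>2" by simp
    then show ?thesis
      by (subst nn_integral_eq_integral[OF i]) (auto intro: ennreal_leI)
  qed
  have "(\<integral>\<^sup>+ \<omega>. ennreal ((cmod (fourier u \<omega>))\<^sup>2) \<partial>lborel)
      = (\<integral>\<^sup>+ \<omega>. liminf (\<lambda>k. ennreal (?e k \<omega> * (cmod (fourier u \<omega>))\<^sup>2)) \<partial>lborel)"
  proof (intro nn_integral_cong)
    fix \<omega>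
    have "(\<lambda>k. ennreal (?e k \<omega> * (cmod (fourier u \<omega>))\<^sup>2)) \<longlonglongrightarrow> ennreal (1 * (cmod (fourier u \<omega>))\<^sup>2)"
      by (intro tendsto_ennrealI tendsto_mult gauss_scale_tendsto tendsto_const)
    from lim_imp_Liminf[OF _ this] show "ennreal ((cmod (fourier u \<omega>))\<^sup>2) = liminf (\<lambda>k. ennreal (?e k \<omega> * (cmod (fourier u \<omega>))\<^sup>2))"
      by simp
  qed
  also have "\<dots> \<le> liminf (\<lambda>k. \<integral>\<^sup>+ \<omega>. ennreal (?e k \<omega> * (cmod (fourier u \<omega>))\<^sup>2) \<partial>lborel)"
    by (rule nn_integral_liminf) simp
  also have "\<dots> \<le> ennreal ((L2_norm_R u)\<^sup>2)"
    by (rule order_trans[OF Liminf_le_Limsup Limsup_bounded]) (simp_all only: sequentially_bot not_False_eq_True le eventually_True)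
  finally have nn: "(\<integral>\<^sup>+ \<omega>. ennreal ((cmod (fourier u \<omega>))\<^sup>2) \<partial>lborel) \<le> ennreal ((L2_norm_R u)\<^sup>2)" .
  have i: "integrable lborel (\<lambda>\<omega>. (cmod (fourier u \<omega>))\<^sup>2)"
    by (rule integrableI_nonneg) (use nn in \<open>auto intro: le_less_trans\<close>)
  then show "square_integrable (fourier u)" by (simp add: square_integrable_def)
  have "(L2_norm_R (fourier u))\<^sup>2 \<le> (L2_norm_R u)\<^sup>2"
    using nn unfolding nn_integral_eq_integral[OF i AE_I2[OF zero_le_power2]]
    by (simp add: L2_norm_power2[of "fourier u"])
  then show "L2_norm_R (fourier u) \<le> L2_norm_R u"
    by (rule power2_le_imp_le) (rule L2_norm_nonneg)
qed

lemma left_commute_cong: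
  fixes a b c x :: complex
  shows "a * b = c \<Longrightarrow> a * (x * b) = x * c"
  by (simp add: mult.left_commute)

text \<open>The substitution x = y + z/(k+1) moves the shrinking width from the density into the
  argument of g. The density is then fixed, its multiple by C dominates, and continuity at the
  single point y suffices.\<close>

lemma gauss_approximate_identity:
  fixes g :: "real \<Rightarrow> complex"
  assumes [measurable]: "g \<in> borel_measurable borel" and C: "\<And>t. cmod (g t) \<le> C" and y: "isCont g y"
  shows "(\<lambda>k. LINT x|lborel. cnj (g x) * of_real (normal_density 0 (1 / real (Suc k)) (x - y))) \<longlonglongrightarrow> cnj (g y)"
proof -
  have e: "(LINT x|lborel. cnj (g x) * of_real (normal_density 0 (1 / real (Suc k)) (x - y)))
      = (LINT z|lborel. cnj (g (y + 1 / real (Suc k) * z)) * of_real (std_normal_density z))" for k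
  proof -
    have "(LINT x|lborel. cnj (g x) * complex_of_real (normal_density 0 (1 / real (Suc k)) (x - y)))
        = \<bar>1 / real (Suc k)\<bar> *\<^sub>R (LINT z|lborel. cnj (g (y + 1 / real (Suc k) * z)) * of_real (normal_density 0 (1 / real (Suc k)) ((y + 1 / real (Suc k) * z) - y)))"
      by (rule lborel_integral_real_affine) simp
    also have "\<dots> = (LINT z|lborel. \<bar>1 / real (Suc k)\<bar> *\<^sub>R (cnj (g (y + 1 / real (Suc k) * z)) * of_real (normal_density 0 (1 / real (Suc k)) ((y + 1 / real (Suc k) * z) - y))))"
      by (rule integral_scaleR_right[symmetric])
    also have "(\<lambda>z. \<bar>1 / real (Suc k)\<bar> *\<^sub>R (cnj (g (y + 1 / real (Suc k) * z)) * complex_of_real (normal_density 0 (1 / real (Suc k)) ((y + 1 / real (Suc k) * z) - y))))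
        = (\<lambda>z. cnj (g (y + 1 / real (Suc k) * z)) * of_real (std_normal_density z))"
    proof
      fix z
      have "\<bar>1 / real (Suc k)\<bar> * normal_density 0 (1 / real (Suc k)) ((y + 1 / real (Suc k) * z) - y) = std_normal_density z"
        by (simp add: normal_density_def real_sqrt_divide real_sqrt_mult power_divide del: of_nat_Suc)
      then have "complex_of_real \<bar>1 / real (Suc k)\<bar> * complex_of_real (normal_density 0 (1 / real (Suc k)) ((y + 1 / real (Suc k) * z) - y)) = of_real (std_normal_density z)"
        by (simp only: of_real_mult[symmetric])
      then show "\<bar>1 / real (Suc k)\<bar> *\<^sub>R (cnj (g (y + 1 / real (Suc k) * z)) * complex_of_real (normal_density 0 (1 / real (Suc k)) ((y + 1 / real (Suc k) * z) - y)))
          = cnj (g (y + 1 / real (Suc k) * z)) * of_real (std_normal_density z)"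
        unfolding scaleR_conv_of_real by (rule left_commute_cong)
    qed
    finally show ?thesis .
  qed
  have si: "integrable lborel (\<lambda>z. complex_of_real (std_normal_density z))"
    by (intro integrable_of_real integrable_normal_density) simp
  have "(\<lambda>k. LINT z|lborel. cnj (g (y + 1 / real (Suc k) * z)) * of_real (std_normal_density z))
      \<longlonglongrightarrow> (LINT z|lborel. cnj (g y) * of_real (std_normal_density z))"
  proof (rule integral_dominated_convergence[where w = "\<lambda>z. C * std_normal_density z"])
    show "integrable lborel (\<lambda>z. C * std_normal_density z)"
      by (intro integrable_mult_right integrable_normal_density) simp
    show "AE z in lborel. (\<lambda>k. cnj (g (y + 1 / real (Suc k) * z)) * complex_of_real (std_normal_density z)) \<longlonglongrightarrow> cnj (g y) * of_real (std_normal_density z)"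
    proof (rule AE_I2)
      fix z
      have "(\<lambda>k. y + inverse (real (Suc k)) * z) \<longlonglongrightarrow> y + 0 * z"
        by (intro tendsto_intros LIMSEQ_inverse_real_of_nat)
      then have "(\<lambda>k. y + 1 / real (Suc k) * z) \<longlonglongrightarrow> y"
        by (simp add: inverse_eq_divide)
      then show "(\<lambda>k. cnj (g (y + 1 / real (Suc k) * z)) * complex_of_real (std_normal_density z)) \<longlonglongrightarrow> cnj (g y) * of_real (std_normal_density z)"
        by (intro tendsto_mult tendsto_cnj isCont_tendsto_compose[OF y] tendsto_const)
    qed
    show "AE z in lborel. norm (cnj (g (y + 1 / real (Suc k) * z)) * complex_of_real (std_normal_density z)) \<le> C * std_normal_density z" for k
      by (rule AE_I2) (simp add: norm_mult normal_density_nonneg mult_right_mono[OF C])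
  qed measurable
  also have "(LINT z|lborel. cnj (g y) * complex_of_real (std_normal_density z)) = cnj (g y)"
    using integral_normal_density[of 1 0] by simp
  finally show ?thesis unfolding e .
qed

lemma parseval_ae_continuous:
  assumes u: "L2_supp R u" and g: "L2_supp R g" and C: "\<And>t. cmod (g t) \<le> C" and cont: "AE y in lborel. isCont g y"
  shows "L2_inner (fourier u) (fourier g) = L2_inner u g"
proof -
  note [measurable] = L2_suppD(2)[OF u] L2_suppD(2)[OF g]
  let ?e = "\<lambda>k \<omega>. exp (- (1 / real (Suc k) * \<omega>)\<^sup>2 / 2)"
  let ?I = "\<lambda>k y. LINT x|lborel. cnj (g x) * complex_of_real (normal_density 0 (1 / real (Suc k)) (x - y))"
  have [measurable]: "?I k \<in> borel_measurable borel" for k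
    by measurable
  have I: "cmod (?I k y) \<le> C" for k y
  proof -
    have "ennreal (cmod (?I k y)) \<le> (\<integral>\<^sup>+ x. ennreal (cmod (cnj (g x) * complex_of_real (normal_density 0 (1 / real (Suc k)) (x - y)))) \<partial>lborel)"
      by (rule norm_integral_le_nn_integral)
    also have "\<dots> \<le> (\<integral>\<^sup>+ x. ennreal C * ennreal (normal_density 0 (1 / real (Suc k)) (x - y)) \<partial>lborel)"
      by (intro nn_integral_mono)
         (auto simp: norm_mult normal_density_nonneg order_trans[OF norm_ge_zero C] intro!: mult_right_mono C simp flip: ennreal_mult)
    also have "\<dots> = ennreal C"
      by (subst nn_integral_cmult) (simp_all add: nn_integral_gauss_shift)
    finally show ?thesis using order_trans[OF norm_ge_zero C] by simp
  qed
  have "(\<lambda>k. LINT \<omega>|lborel. of_real (?e k \<omega>) * (fourier u \<omega> * cnj (fourier g \<omega>)))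
      \<longlonglongrightarrow> (LINT \<omega>|lborel. fourier u \<omega> * cnj (fourier g \<omega>))"
  proof (rule integral_dominated_convergence[where w = "\<lambda>\<omega>. cmod (fourier u \<omega>) * cmod (fourier g \<omega>)"])
    show "integrable lborel (\<lambda>\<omega>. cmod (fourier u \<omega>) * cmod (fourier g \<omega>))"
      by (intro integrable_cmod_mult fourier_L2[OF u] fourier_L2[OF g])
    show "AE \<omega> in lborel. (\<lambda>k. of_real (?e k \<omega>) * (fourier u \<omega> * cnj (fourier g \<omega>))) \<longlonglongrightarrow> fourier u \<omega> * cnj (fourier g \<omega>)"
    proof (rule AE_I2)
      fix \<omega>
      have "(\<lambda>k. complex_of_real (?e k \<omega>) * (fourier u \<omega> * cnj (fourier g \<omega>))) \<longlonglongrightarrow> of_real 1 * (fourier u \<omega> * cnj (fourier g \<omega>))"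
        by (intro tendsto_mult tendsto_of_real gauss_scale_tendsto tendsto_const)
      then show "(\<lambda>k. complex_of_real (?e k \<omega>) * (fourier u \<omega> * cnj (fourier g \<omega>))) \<longlonglongrightarrow> fourier u \<omega> * cnj (fourier g \<omega>)"
        by simp
    qed
    show "AE \<omega> in lborel. norm (of_real (?e k \<omega>) * (fourier u \<omega> * cnj (fourier g \<omega>))) \<le> cmod (fourier u \<omega>) * cmod (fourier g \<omega>)" for k
      by (rule AE_I2) (simp add: norm_mult mult_left_le_one_le)
  qed measurable
  moreover have "(LINT \<omega>|lborel. of_real (?e k \<omega>) * (fourier u \<omega> * cnj (fourier g \<omega>))) = (LINT y|lborel. u y * ?I k y)" for k
    by (rule fourier_gauss_parseval) (use L2_suppD(3)[OF u] L2_suppD(3)[OF g] in auto)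
  moreover have "(\<lambda>k. LINT y|lborel. u y * ?I k y) \<longlonglongrightarrow> (LINT y|lborel. u y * cnj (g y))"
  proof (rule integral_dominated_convergence[where w = "\<lambda>y. cmod (u y) * C"])
    show "integrable lborel (\<lambda>y. cmod (u y) * C)"
      using L2_suppD(3)[OF u] by simp
    show "AE y in lborel. (\<lambda>k. u y * ?I k y) \<longlonglongrightarrow> u y * cnj (g y)"
      using cont
    proof eventually_elim
      case (elim y)
      show ?case
        by (intro tendsto_mult tendsto_const gauss_approximate_identity[OF _ C elim]) measurable
    qed
    show "AE y in lborel. norm (u y * ?I k y) \<le> cmod (u y) * C" for k
      by (rule AE_I2) (simp only: norm_mult, intro mult_left_mono I norm_ge_zero)
  qed measurable
  ultimately show ?thesis
    unfolding L2_inner_def by (auto intro: LIMSEQ_unique)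
qed

lemma L2_inner_diff_right:
  assumes "square_integrable f" "square_integrable g" "square_integrable h"
  shows "L2_inner f (\<lambda>t. g t - h t) = L2_inner f g - L2_inner f h"
  using integrable_mult_cnj[OF assms(1,2)] integrable_mult_cnj[OF assms(1,3)]
  by (simp add: L2_inner_def right_diff_distrib)

text \<open>The defect of Parseval's identity is additive in the second argument and vanishes for
  \<open>G j\<close>; by contractivity and Cauchy-Schwarz it is at most twice the product of the
  norms of u and \<open>g - G j\<close>.\<close>

lemma parseval_closure:
  assumes u: "L2_supp R u" and g: "L2_supp R g" and G: "\<And>j. L2_supp R (G j)"
    and eq: "\<And>j. L2_inner (fourier u) (fourier (G j)) = L2_inner u (G j)"
    and lim: "(\<lambda>j. LINT t|lborel. (cmod (g t - G j t))\<^sup>2) \<longlonglongrightarrow> 0"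
  shows "L2_inner (fourier u) (fourier g) = L2_inner u g"
proof -
  have "cmod (L2_inner (fourier u) (fourier g) - L2_inner u g) \<le> 2 * L2_norm_R u * L2_norm_R (\<lambda>t. g t - G j t)" for j
  proof -
    let ?d = "\<lambda>t. g t - G j t"
    have d: "L2_supp R ?d" by (rule L2_supp_diff[OF g G])
    have fd: "fourier ?d = (\<lambda>\<omega>. fourier g \<omega> - fourier (G j) \<omega>)"
      using L2_suppD(3)[OF g] L2_suppD(3)[OF G] by (auto simp: fourier_diff)
    have "L2_inner (fourier u) (fourier g) - L2_inner u g = L2_inner (fourier u) (fourier ?d) - L2_inner u ?d"
      unfolding fd
      by (simp add: L2_inner_diff_right fourier_L2(1)[OF u] fourier_L2(1)[OF g] fourier_L2(1)[OF G] L2_suppD(1)[OF u] L2_suppD(1)[OF g] L2_suppD(1)[OF G] eq)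
    also have "cmod \<dots> \<le> cmod (L2_inner (fourier u) (fourier ?d)) + cmod (L2_inner u ?d)"
      by (rule norm_triangle_ineq4)
    also have "\<dots> \<le> L2_norm_R (fourier u) * L2_norm_R (fourier ?d) + L2_norm_R u * L2_norm_R ?d"
      by (intro add_mono Cauchy_Schwarz_L2 fourier_L2(1)[OF u] fourier_L2(1)[OF d] L2_suppD(1)[OF u] L2_suppD(1)[OF d])
    also have "\<dots> \<le> L2_norm_R u * L2_norm_R ?d + L2_norm_R u * L2_norm_R ?d"
      by (intro add_mono mult_mono fourier_L2(2)[OF u] fourier_L2(2)[OF d] L2_norm_nonneg order_refl)
    finally show ?thesis by simp
  qed
  moreover have "(\<lambda>j. 2 * L2_norm_R u * L2_norm_R (\<lambda>t. g t - G j t)) \<longlonglongrightarrow> 2 * L2_norm_R u * sqrt 0"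
    using lim unfolding L2_norm_R_def[of "\<lambda>t. g t - _ t"] by (intro tendsto_mult tendsto_const tendsto_real_sqrt)
  ultimately have "cmod (L2_inner (fourier u) (fourier g) - L2_inner u g) \<le> 2 * L2_norm_R u * sqrt 0"
    by (intro LIMSEQ_le_const) auto
  then show ?thesis by simp
qed

text \<open>A measurable g is an almost everywhere limit of continuous functions \<open>h j\<close>.
  Cutting these off to [-R,R] keeps them in the class and creates jumps at most at R and -R, so the
  almost everywhere continuous case applies to them.\<close>

lemma parseval_bounded:
  assumes u: "L2_supp R u" and g: "L2_supp R g" and C: "\<And>t. cmod (g t) \<le> C"
  shows "L2_inner (fourier u) (fourier g) = L2_inner u g"
proof -
  note [measurable] = L2_suppD(2)[OF g]
  have "0 \<le> C" using C[of 0] norm_ge_zero order_trans by blast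
  have "g measurable_on UNIV"
    by (rule lebesgue_measurable_imp_measurable_on) (simp_all add: measurable_completion)
  then obtain N h where N: "negligible N" and h: "\<And>j. continuous_on UNIV (h j)" and lim: "\<And>x. x \<notin> N \<Longrightarrow> (\<lambda>j. h j x) \<longlonglongrightarrow> g x"
    unfolding measurable_on_def by auto
  \<comment> \<open>Projecting the values onto the disc of radius C is continuous and fixes the
    values of g; it keeps the approximants uniformly bounded, which supplies the dominating
    function.\<close>
  let ?c = "closest_point (cball (0::complex) C)"
  let ?G = "\<lambda>j t. indicator {-R..R} t *\<^sub>R ?c (h j t)"
  have cc: "continuous_on UNIV ?c"
    using \<open>0 \<le> C\<close> by (intro continuous_on_closest_point) auto
  have cle: "cmod (?c z) \<le> C" for z
    using closest_point_in_set[of "cball (0::complex) C" z] \<open>0 \<le> C\<close> by auto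
  have ch: "continuous_on UNIV (\<lambda>t. ?c (h j t))" for j
    by (rule continuous_on_compose2[OF cc h]) auto
  then have [measurable]: "(\<lambda>t. ?c (h j t)) \<in> borel_measurable borel" for j
    by (rule borel_measurable_continuous_onI)
  have Gle: "cmod (?G j t) \<le> indicator {-R..R} t * C" for j t
    using cle by (auto simp: indicator_def)
  have gle: "cmod (g t) \<le> indicator {-R..R} t * C" for t
    using C L2_suppD(4)[OF g] by (auto simp: indicator_def)
  have ind: "integrable lborel (\<lambda>t. indicator {-R..R} t * c)" for c :: real
    by (intro integrable_mult_left integrable_real_indicator) (simp_all add: emeasure_lborel_Icc_eq)
  have G: "L2_supp R (?G j)" for j
    unfolding L2_supp_def square_integrable_def
  proof (intro conjI allI impI)
    show "integrable lborel (\<lambda>t. (cmod (?G j t))\<^sup>2)"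
    proof (rule Bochner_Integration.integrable_bound[OF ind[of "C\<^sup>2"]])
      show "AE t in lborel. norm ((cmod (?G j t))\<^sup>2) \<le> norm (indicator {-R..R} t * C\<^sup>2)"
        by (rule AE_I2) (use cle in \<open>auto simp: indicator_def intro!: power_mono\<close>)
    qed measurable
    show "0 \<le> R" using g by (simp add: L2_supp_def)
  qed (auto simp: indicator_def)
  have aeN: "AE t in lborel. t \<notin> N"
    using AE_not_in[of N lebesgue] N unfolding negligible_iff_null_sets AE_completion_iff by blast
  show ?thesis
  proof (rule parseval_closure[OF u g G])
    fix j :: nat
    have "AE t in lborel. t \<noteq> R" "AE t in lborel. t \<noteq> -R"
      by (auto intro: AE_lborel_singleton)
    then have "AE t in lborel. isCont (?G j) t"
    proof eventually_elim
      case (elim t)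
      have *: "continuous_on ({-R<..<R} \<union> ({..<-R} \<union> {R<..})) (?G j)"
      proof (rule continuous_on_open_Un)
        show "continuous_on {-R<..<R} (?G j)"
          by (rule continuous_on_eq[OF continuous_on_subset[OF ch[of j]]]) auto
        show "continuous_on ({..<-R} \<union> {R<..}) (?G j)"
          by (rule continuous_on_eq[OF continuous_on_const[of _ 0]]) (use g in \<open>auto simp: L2_supp_def\<close>)
      qed auto
      have "t \<in> {-R<..<R} \<union> ({..<-R} \<union> {R<..})" using elim by auto
      then show ?case
        using * by (subst (asm) continuous_on_eq_continuous_at)
          (intro open_Un open_greaterThanLessThan open_lessThan open_greaterThan, blast)
    qed
    then show "L2_inner (fourier u) (fourier (?G j)) = L2_inner u (?G j)"
      by (rule parseval_ae_continuous[OF u G, rotated]) (use Gle \<open>0 \<le> C\<close> in \<open>auto simp: indicator_def cle\<close>)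
  next
    have "(\<lambda>j. LINT t|lborel. (cmod (g t - ?G j t))\<^sup>2) \<longlonglongrightarrow> (LINT t|(lborel::real measure). (0::real))"
    proof (rule integral_dominated_convergence[where w = "\<lambda>t. indicator {-R..R} t * (2 * C)\<^sup>2"])
      show "AE t in lborel. (\<lambda>j. (cmod (g t - ?G j t))\<^sup>2) \<longlonglongrightarrow> 0"
        using aeN
      proof eventually_elim
        case (elim t)
        have "(\<lambda>j. ?c (h j t)) \<longlonglongrightarrow> ?c (g t)"
          by (rule continuous_on_tendsto_compose[OF cc lim[OF elim]]) auto
        also have "?c (g t) = g t" using C by (intro closest_point_self) simp
        finally have "(\<lambda>j. (cmod (g t - ?G j t))\<^sup>2) \<longlonglongrightarrow> (cmod (g t - indicator {-R..R} t *\<^sub>R g t))\<^sup>2"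
          by (intro tendsto_intros)
        moreover have "indicator {-R..R} t *\<^sub>R g t = g t" using L2_suppD(4)[OF g] by (auto simp: indicator_def)
        ultimately show ?case by simp
      qed
      show "AE t in lborel. norm ((cmod (g t - ?G j t))\<^sup>2) \<le> indicator {-R..R} t * (2 * C)\<^sup>2" for j
      proof (rule AE_I2)
        fix t
        have "cmod (g t - ?G j t) \<le> indicator {-R..R} t * (2 * C)"
          using norm_triangle_ineq4[of "g t" "?G j t"] gle[of t] Gle[of t j] by simp
        then have "(cmod (g t - ?G j t))\<^sup>2 \<le> (indicator {-R..R} t * (2 * C))\<^sup>2"
          by (intro power_mono) auto
        also have "\<dots> = indicator {-R..R} t * (2 * C)\<^sup>2" by (simp add: indicator_def)
        finally show "norm ((cmod (g t - ?G j t))\<^sup>2) \<le> indicator {-R..R} t * (2 * C)\<^sup>2" by simp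
      qed
    qed (use ind in measurable)
    then show "(\<lambda>j. LINT t|lborel. (cmod (g t - ?G j t))\<^sup>2) \<longlonglongrightarrow> 0" by simp
  qed
qed

text \<open>Cutting off large values of g, rather than large arguments, reduces to the bounded case;
  at each point the truncation is eventually inactive.\<close>

theorem parseval:
  assumes u: "L2_supp R u" and g: "L2_supp R g"
  shows "L2_inner (fourier u) (fourier g) = L2_inner u g"
proof -
  note [measurable] = L2_suppD(2)[OF g]
  let ?S = "\<lambda>j::nat. {t. cmod (g t) \<le> real j}"
  let ?G = "\<lambda>j t. indicator (?S j) t *\<^sub>R g t"
  have G: "L2_supp R (?G j)" for j
    unfolding L2_supp_def
    using square_integrable_restrict[OF L2_suppD(1)[OF g], of "?S j"] g by (simp add: L2_supp_def)
  show ?thesis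
  proof (rule parseval_closure[OF u g G])
    show "L2_inner (fourier u) (fourier (?G j)) = L2_inner u (?G j)" for j
      by (rule parseval_bounded[OF u G, of j "real j"]) (auto simp: indicator_def)
    have "(\<lambda>j. LINT t|lborel. (cmod (g t - ?G j t))\<^sup>2) \<longlonglongrightarrow> (LINT t|(lborel::real measure). (0::real))"
    proof (rule integral_dominated_convergence[where w = "\<lambda>t. (cmod (g t))\<^sup>2"])
      show "integrable lborel (\<lambda>t. (cmod (g t))\<^sup>2)"
        by (rule square_integrableD(2)[OF L2_suppD(1)[OF g]])
      show "AE t in lborel. (\<lambda>j. (cmod (g t - ?G j t))\<^sup>2) \<longlonglongrightarrow> 0"
      proof (rule AE_I2)
        fix t
        obtain m where m: "cmod (g t) \<le> real m" using real_arch_simple by blast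
        have "\<forall>\<^sub>F j in sequentially. 0 = (cmod (g t - ?G j t))\<^sup>2"
          using eventually_ge_at_top[of m] by eventually_elim (use m in \<open>auto simp: indicator_def\<close>)
        then show "(\<lambda>j. (cmod (g t - ?G j t))\<^sup>2) \<longlonglongrightarrow> 0"
          by (rule Lim_transform_eventually[OF tendsto_const])
      qed
      show "AE t in lborel. norm ((cmod (g t - ?G j t))\<^sup>2) \<le> (cmod (g t))\<^sup>2" for j
        by (rule AE_I2) (auto simp: indicator_def)
    qed measurable
    then show "(\<lambda>j. LINT t|lborel. (cmod (g t - ?G j t))\<^sup>2) \<longlonglongrightarrow> 0" by simp
  qed
qed

section \<open>Hermite projections of almost time- and band-limited functions\<close>

lemma square_integrable_cmult: "square_integrable f \<Longrightarrow> square_integrable (\<lambda>t. c * f t)"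
  by (auto simp: square_integrable_def norm_mult power_mult_distrib)

lemma square_integrable_add:
  assumes "square_integrable f" "square_integrable g"
  shows "square_integrable (\<lambda>t. f t + g t)"
  using square_integrable_diff[OF assms(1) square_integrable_cmult[OF assms(2), of "-1"]] by simp

lemma square_integrable_sum:
  "(\<And>i. i \<in> I \<Longrightarrow> square_integrable (f i)) \<Longrightarrow> square_integrable (\<lambda>t. \<Sum>i\<in>I. f i t)"
proof (induction I rule: infinite_finite_induct)
  case (insert i I)
  then show ?case by (simp add: square_integrable_add)
qed (simp_all add: square_integrable_def)

lemma L2_inner_diff_left:
  assumes "square_integrable f" "square_integrable g" "square_integrable h"
  shows "L2_inner (\<lambda>t. f t - g t) h = L2_inner f h - L2_inner g h"
  using integrable_mult_cnj[OF assms(1,3)] integrable_mult_cnj[OF assms(2,3)]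
  by (simp add: L2_inner_def left_diff_distrib)

lemma L2_inner_cmult_left: "L2_inner (\<lambda>t. c * f t) g = c * L2_inner f g"
  by (simp add: L2_inner_def mult.assoc)

lemma L2_inner_sum_left:
  assumes "\<And>i. i \<in> I \<Longrightarrow> square_integrable (f i)" "square_integrable g"
  shows "L2_inner (\<lambda>t. \<Sum>i\<in>I. f i t) g = (\<Sum>i\<in>I. L2_inner (f i) g)"
  unfolding L2_inner_def sum_distrib_right
  by (rule Bochner_Integration.integral_sum) (intro integrable_mult_cnj assms)

lemma L2_inner_commute: "L2_inner g f = cnj (L2_inner f g)"
  unfolding L2_inner_def Bochner_Integration.integral_cnj[symmetric] by (simp add: mult.commute)

lemma L2_inner_self: "L2_inner f f = of_real ((L2_norm_R f)\<^sup>2)"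
  unfolding L2_inner_def L2_norm_power2 integral_complex_of_real[symmetric]
  by (simp only: complex_norm_square)

abbreviation hermite_cfun :: "nat \<Rightarrow> real \<Rightarrow> complex" where
  "hermite_cfun k \<equiv> \<lambda>x. complex_of_real (hermite_fun k x)"

lemma measurable_hermite_fun [measurable]: "hermite_fun n \<in> borel_measurable borel"
  by (intro borel_measurable_continuous_onI continuous_hermite_fun continuous_on_id)

lemma square_integrable_hermite: "square_integrable (hermite_cfun k)"
  unfolding square_integrable_def
proof
  show "integrable lborel (\<lambda>t. (cmod (hermite_cfun k t))\<^sup>2)"
    using integrable_hermite_fun_mult[of k k] by (simp add: power2_eq_square)
qed measurable

lemma L2_inner_hermite: "L2_inner (hermite_cfun j) (hermite_cfun k) = (if j = k then 1 else 0)"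
  using hermite_orthonormal[of j k]
  by (simp add: L2_inner_def flip: of_real_mult)

lemma L2_norm_remove_component:
  assumes g: "square_integrable g" and h: "square_integrable h" "L2_inner h h = 1"
  shows "(L2_norm_R (\<lambda>t. g t - L2_inner g h * h t))\<^sup>2 = (L2_norm_R g)\<^sup>2 - (cmod (L2_inner g h))\<^sup>2"
proof -
  let ?c = "L2_inner g h"
  have ch: "square_integrable (\<lambda>t. ?c * h t)" by (rule square_integrable_cmult[OF h(1)])
  have "complex_of_real ((L2_norm_R (\<lambda>t. g t - ?c * h t))\<^sup>2) = L2_inner (\<lambda>t. g t - ?c * h t) (\<lambda>t. g t - ?c * h t)"
    by (rule L2_inner_self[symmetric])
  also have "\<dots> = L2_inner g g - L2_inner g (\<lambda>t. ?c * h t) - (L2_inner (\<lambda>t. ?c * h t) g - L2_inner (\<lambda>t. ?c * h t) (\<lambda>t. ?c * h t))"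
    by (simp add: L2_inner_diff_left L2_inner_diff_right g ch square_integrable_diff)
  also have "L2_inner g (\<lambda>t. ?c * h t) = cnj (L2_inner (\<lambda>t. ?c * h t) g)"
    by (rule L2_inner_commute)
  also have "L2_inner (\<lambda>t. ?c * h t) g = ?c * cnj ?c"
    by (simp add: L2_inner_cmult_left L2_inner_commute[of h g])
  also have "L2_inner (\<lambda>t. ?c * h t) (\<lambda>t. ?c * h t) = ?c * cnj ?c"
    by (simp add: L2_inner_cmult_left L2_inner_commute[of h "\<lambda>t. ?c * h t"] h(2))
  finally have "complex_of_real ((L2_norm_R (\<lambda>t. g t - ?c * h t))\<^sup>2) = of_real ((L2_norm_R g)\<^sup>2 - (cmod ?c)\<^sup>2)"
    by (simp only: L2_inner_self of_real_diff complex_norm_square complex_cnj_mult complex_cnj_cnj) (simp add: mult.commute)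
  then show ?thesis by (simp only: of_real_eq_iff)
qed

text \<open>One component is removed at a time. The third conjunct, that the later coefficients are
  still those of f, is what lets \<open>L2_norm_remove_component\<close> apply at the next step, so
  all three claims are carried through one induction.\<close>

lemma Bessel_identity:
  assumes f: "square_integrable f"
  shows "square_integrable (\<lambda>t. f t - (\<Sum>k<N. L2_inner f (hermite_cfun k) * hermite_cfun k t))
    \<and> (L2_norm_R (\<lambda>t. f t - (\<Sum>k<N. L2_inner f (hermite_cfun k) * hermite_cfun k t)))\<^sup>2
       = (L2_norm_R f)\<^sup>2 - (\<Sum>k<N. (cmod (L2_inner f (hermite_cfun k)))\<^sup>2)
    \<and> (\<forall>j\<ge>N. L2_inner (\<lambda>t. f t - (\<Sum>k<N. L2_inner f (hermite_cfun k) * hermite_cfun k t)) (hermite_cfun j)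
         = L2_inner f (hermite_cfun j))"
proof (induction N)
  case 0
  then show ?case using f by simp
next
  case (Suc N)
  let ?g = "\<lambda>t. f t - (\<Sum>k<N. L2_inner f (hermite_cfun k) * hermite_cfun k t)"
  let ?h = "\<lambda>t. L2_inner f (hermite_cfun N) * hermite_cfun N t"
  have g: "square_integrable ?g" and gN: "L2_inner ?g (hermite_cfun N) = L2_inner f (hermite_cfun N)"
    using Suc.IH by auto
  have e: "(\<lambda>t. f t - (\<Sum>k<Suc N. L2_inner f (hermite_cfun k) * hermite_cfun k t)) = (\<lambda>t. ?g t - ?h t)"
    by (simp add: algebra_simps)
  have h: "square_integrable ?h" by (intro square_integrable_cmult square_integrable_hermite)
  have "(L2_norm_R (\<lambda>t. ?g t - ?h t))\<^sup>2 = (L2_norm_R ?g)\<^sup>2 - (cmod (L2_inner f (hermite_cfun N)))\<^sup>2"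
    using L2_norm_remove_component[OF g square_integrable_hermite[of N]] unfolding gN
    by (simp add: L2_inner_hermite)
  moreover have "L2_inner (\<lambda>t. ?g t - ?h t) (hermite_cfun j) = L2_inner f (hermite_cfun j)" if "j \<ge> Suc N" for j
    using Suc.IH that
    by (subst L2_inner_diff_left[OF g h square_integrable_hermite]) (simp add: L2_inner_cmult_left L2_inner_hermite)
  ultimately show ?case
    unfolding e using Suc.IH square_integrable_diff[OF g h] by simp
qed

lemma hermite_proj_eq: "hermite_proj n f t = (\<Sum>k<Suc n. L2_inner f (hermite_cfun k) * hermite_cfun k t)"
  by (simp only: hermite_proj_def lessThan_Suc_atMost)

lemma square_integrable_hermite_proj: "square_integrable (hermite_proj n f)"
  unfolding hermite_proj_def[abs_def] by (intro square_integrable_sum square_integrable_cmult square_integrable_hermite)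

lemma L2_norm_hermite_proj_compl:
  assumes "square_integrable f"
  shows "L2_norm_R (\<lambda>t. f t - hermite_proj n f t) \<le> L2_norm_R f"
proof (rule power2_le_imp_le)
  show "(L2_norm_R (\<lambda>t. f t - hermite_proj n f t))\<^sup>2 \<le> (L2_norm_R f)\<^sup>2"
    unfolding hermite_proj_eq using Bessel_identity[OF assms, of "Suc n"] by (simp add: sum_nonneg del: sum.lessThan_Suc)
qed (rule L2_norm_nonneg)

lemma Bessel_inequality:
  assumes "square_integrable f"
  shows "(\<Sum>k\<le>n. (cmod (L2_inner f (hermite_cfun k)))\<^sup>2) \<le> (L2_norm_R f)\<^sup>2"
proof -
  have "0 \<le> (L2_norm_R (\<lambda>t. f t - (\<Sum>k<Suc n. L2_inner f (hermite_cfun k) * hermite_cfun k t)))\<^sup>2"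
    by simp
  also have "\<dots> = (L2_norm_R f)\<^sup>2 - (\<Sum>k<Suc n. (cmod (L2_inner f (hermite_cfun k)))\<^sup>2)"
    using Bessel_identity[OF assms, of "Suc n"] by blast
  finally show ?thesis by (simp only: lessThan_Suc_atMost)
qed

lemma L2_inner_hermite_proj:
  assumes "square_integrable g"
  shows "L2_inner (hermite_proj n f) g = (\<Sum>k\<le>n. L2_inner f (hermite_cfun k) * cnj (L2_inner g (hermite_cfun k)))"
  unfolding hermite_proj_def[abs_def]
  by (subst L2_inner_sum_left)
     (auto intro!: square_integrable_cmult square_integrable_hermite assms simp: L2_inner_cmult_left L2_inner_commute[of _ g])

text \<open>In Hermite coefficients the pairing is a finite sum, so the discrete Cauchy-Schwarz
  inequality and Bessel's inequality for each factor suffice.\<close>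

lemma L2_inner_hermite_proj_le:
  assumes "square_integrable f" "square_integrable g"
  shows "cmod (L2_inner (hermite_proj n f) g) \<le> L2_norm_R f * L2_norm_R g"
proof -
  let ?a = "\<lambda>k. cmod (L2_inner f (hermite_cfun k))" and ?b = "\<lambda>k. cmod (L2_inner g (hermite_cfun k))"
  have "cmod (L2_inner (hermite_proj n f) g) \<le> (\<Sum>k\<le>n. ?a k * ?b k)"
    unfolding L2_inner_hermite_proj[OF assms(2)] by (rule order_trans[OF norm_sum]) (simp add: norm_mult)
  also have "\<dots> \<le> L2_norm_R f * L2_norm_R g"
  proof (rule power2_le_imp_le)
    have "(\<Sum>k\<le>n. ?a k * ?b k)\<^sup>2 \<le> (\<Sum>k\<le>n. (?a k)\<^sup>2) * (\<Sum>k\<le>n. (?b k)\<^sup>2)"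
      by (rule Cauchy_Schwarz_ineq_sum)
    also have "\<dots> \<le> (L2_norm_R f)\<^sup>2 * (L2_norm_R g)\<^sup>2"
      by (intro mult_mono Bessel_inequality assms sum_nonneg) auto
    finally show "(\<Sum>k\<le>n. ?a k * ?b k)\<^sup>2 \<le> (L2_norm_R f * L2_norm_R g)\<^sup>2" by (simp add: power_mult_distrib)
  qed (simp add: L2_norm_nonneg)
  finally show ?thesis .
qed

section \<open>Hermite projection versus band limiting\<close>

lemma integrable_indicator_Icc:
  fixes N :: real
  shows "integrable lborel (\<lambda>x. complex_of_real (indicator {-N..N} x))"
  by (intro integrable_of_real integrable_real_indicator) (simp_all add: emeasure_lborel_Icc_eq)

lemma integral_cis_Icc:
  assumes "0 \<le> N" "d \<noteq> 0"
  shows "(LINT \<omega>|lborel. complex_of_real (indicator {-N..N} \<omega>) * cis (\<omega> * d)) = of_real (2 * sin (N * d) / d)"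
proof -
  let ?F = "\<lambda>z. exp (\<i> * z * of_real d) / (\<i> * of_real d)"
  have d: "((\<lambda>x. ?F (of_real x)) has_vector_derivative cis (x * d)) (at x within S)" for x S
  proof (rule has_vector_derivative_real_field)
    show "(?F has_field_derivative cis (x * d)) (at (of_real x))"
      by (rule derivative_eq_intros refl | use assms(2) in \<open>simp add: cis_conv_exp mult_ac\<close>)+
  qed
  have "(LINT \<omega>|lborel. indicator {-N..N} \<omega> *\<^sub>R cis (\<omega> * d)) = ?F (of_real N) - ?F (of_real (- N))"
    by (rule integral_FTC_Icc) (use assms d in \<open>auto intro!: continuous_intros\<close>)
  also have "\<dots> = (cis (N * d) - cis (- (N * d))) / (\<i> * of_real d)"
    by (simp add: cis_conv_exp mult_ac diff_divide_distrib)
  also have "cis (N * d) - cis (- (N * d)) = 2 * \<i> * of_real (sin (N * d))"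
    by (simp add: complex_eq_iff)
  finally show ?thesis using assms(2) by (simp add: scaleR_conv_of_real)
qed

text \<open>The kernel is a finite sum of products in separated variables, so linearity of the
  integral replaces Fubini's theorem.\<close>

lemma hermite_kernel_integral:
  assumes u: "L2_supp T u" and g: "L2_supp T g"
  shows "integrable lborel (\<lambda>y. u y * (LINT x|lborel. cnj (g x) * of_real (hermite_kernel n x y)))"
    and "L2_inner (hermite_proj n u) g = (LINT y|lborel. u y * (LINT x|lborel. cnj (g x) * of_real (hermite_kernel n x y)))"
proof -
  note sq = L2_suppD(1)[OF u] L2_suppD(1)[OF g]
  have i: "integrable lborel (\<lambda>x. cnj (g x) * hermite_cfun k x)" for k
    using integrable_mult_cnj[OF square_integrable_hermite sq(2), of k] by (simp add: mult.commute)
  have "(LINT x|lborel. cnj (g x) * of_real (hermite_kernel n x y)) = (\<Sum>k\<le>n. hermite_cfun k y * cnj (L2_inner g (hermite_cfun k)))" for y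
  proof -
    have "(LINT x|lborel. cnj (g x) * of_real (hermite_kernel n x y)) = (LINT x|lborel. (\<Sum>k\<le>n. (cnj (g x) * hermite_cfun k x) * hermite_cfun k y))"
      by (simp add: hermite_kernel_def sum_distrib_left mult.assoc)
    also have "\<dots> = (\<Sum>k\<le>n. LINT x|lborel. (cnj (g x) * hermite_cfun k x) * hermite_cfun k y)"
      by (intro Bochner_Integration.integral_sum integrable_mult_left i)
    also have "\<dots> = (\<Sum>k\<le>n. hermite_cfun k y * (LINT x|lborel. cnj (g x) * hermite_cfun k x))"
      by (simp add: mult.commute)
    finally show ?thesis
      by (simp add: L2_inner_def flip: Bochner_Integration.integral_cnj)
  qed
  then have e: "u y * (LINT x|lborel. cnj (g x) * of_real (hermite_kernel n x y))
      = (\<Sum>k\<le>n. (u y * cnj (hermite_cfun k y)) * cnj (L2_inner g (hermite_cfun k)))" for y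
    by (simp add: sum_distrib_left mult.assoc)
  have iu: "integrable lborel (\<lambda>y. (u y * cnj (hermite_cfun k y)) * c)" for k c
    by (intro integrable_mult_left integrable_mult_cnj sq square_integrable_hermite)
  show "integrable lborel (\<lambda>y. u y * (LINT x|lborel. cnj (g x) * of_real (hermite_kernel n x y)))"
    unfolding e by (intro Bochner_Integration.integrable_sum iu)
  show "L2_inner (hermite_proj n u) g = (LINT y|lborel. u y * (LINT x|lborel. cnj (g x) * of_real (hermite_kernel n x y)))"
    unfolding e L2_inner_hermite_proj[OF sq(2)]
    by (subst Bochner_Integration.integral_sum[OF iu]) (simp add: L2_inner_def)
qed

lemma norm_integral_le_AE:
  fixes f :: "'a \<Rightarrow> 'b::{banach, second_countable_topology}"
  assumes "integrable M f" "integrable M g" "AE x in M. norm (f x) \<le> g x"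
  shows "norm (integral\<^sup>L M f) \<le> integral\<^sup>L M g"
  by (rule order_trans[OF integral_norm_bound integral_mono_AE[OF integrable_norm[OF assms(1)] assms(2,3)]])

text \<open>\<open>E\<close> is kept as an integral over the band rather than as a sine quotient:
  its modulus is then bounded by one constant for all arguments, including 0, and integrability
  follows from that of u and g.\<close>

lemma sinc_kernel_integral:
  fixes N T :: real
  assumes u: "L2_supp T u" and g: "L2_supp T g"
  defines "E \<equiv> \<lambda>x. LINT \<omega>|lborel. complex_of_real (indicator {-N..N} \<omega>) * cis (\<omega> * x)"
  shows "integrable lborel (\<lambda>y. u y * (LINT x|lborel. cnj (g x) * E (x - y)))"
    and "integrable lborel (\<lambda>x. cnj (g x) * E (x - y))"
    and "(LINT \<omega>|lborel. complex_of_real (indicator {-N..N} \<omega>) * (fourier u \<omega> * cnj (fourier g \<omega>)))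
      = 1 / (2 * pi) * (LINT y|lborel. u y * (LINT x|lborel. cnj (g x) * E (x - y)))"
proof -
  note [measurable] = L2_suppD(2)[OF u] L2_suppD(2)[OF g]
  note i = L2_suppD(3)[OF u] L2_suppD(3)[OF g]
  have [measurable]: "E \<in> borel_measurable borel"
    unfolding E_def by measurable
  define C where "C = (LINT \<omega>|lborel. cmod (complex_of_real (indicator {-N..N} \<omega>)))"
  have E: "cmod (E x) \<le> C" for x
    unfolding E_def C_def by (rule order_trans[OF integral_norm_bound]) (simp add: norm_mult)
  show ig: "integrable lborel (\<lambda>x. cnj (g x) * E (x - y))" for y
    by (rule integrable_mult_bounded[OF _ _ E]) (use i in simp_all)
  show "integrable lborel (\<lambda>y. u y * (LINT x|lborel. cnj (g x) * E (x - y)))"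
  proof (rule integrable_mult_bounded[OF i(1), where C = "(LINT x|lborel. cmod (g x)) * C"])
    fix y
    have "cmod (LINT x|lborel. cnj (g x) * E (x - y)) \<le> (LINT x|lborel. cmod (g x) * C)"
      by (rule norm_integral_le_AE[OF ig]) (use i in \<open>auto simp: norm_mult intro!: AE_I2 mult_left_mono E\<close>)
    then show "cmod (LINT x|lborel. cnj (g x) * E (x - y)) \<le> (LINT x|lborel. cmod (g x)) * C" by simp
  qed measurable
  show "(LINT \<omega>|lborel. complex_of_real (indicator {-N..N} \<omega>) * (fourier u \<omega> * cnj (fourier g \<omega>)))
      = 1 / (2 * pi) * (LINT y|lborel. u y * (LINT x|lborel. cnj (g x) * E (x - y)))"
    unfolding E_def by (rule fourier_weighted_parseval[OF integrable_indicator_Icc i])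
qed

text \<open>Both pairings are double integrals of u and g against a kernel, and on the square
  [-T,T]^2 the kernels differ by at most 7T^2/mu. The L1 norms of u and g contribute sqrt(2T) each,
  hence the constant 14 and the power T^3.\<close>

lemma hermite_proj_vs_band_limiting:
  assumes u: "L2_supp T u" and g: "L2_supp T g" and T: "1 \<le> T" "4 * T \<le> sqrt (2 * real n + 2)"
  defines "\<mu> \<equiv> sqrt (2 * real n + 2)"
  shows "cmod ((LINT \<omega>|lborel. complex_of_real (indicator {-\<mu>..\<mu>} \<omega>) * (fourier u \<omega> * cnj (fourier g \<omega>))) - L2_inner (hermite_proj n u) g)
     \<le> 14 * T ^ 3 / \<mu> * L2_norm_R u * L2_norm_R g"
proof -
  define E where "E = (\<lambda>x. LINT \<omega>|lborel. complex_of_real (indicator {-\<mu>..\<mu>} \<omega>) * cis (\<omega> * x))"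
  have mu: "0 < \<mu>" by (simp add: \<mu>_def)
  note i = L2_suppD(3)[OF u] L2_suppD(3)[OF g]
  have E: "(LINT \<omega>|lborel. complex_of_real (indicator {-\<mu>..\<mu>} \<omega>) * cis (\<omega> * x)) = E x" for x
    by (simp add: E_def)
  note S = sinc_kernel_integral[OF u g, of \<mu>, unfolded E]
  note K = hermite_kernel_integral[OF u g, of n]
  let ?B = "7 * T\<^sup>2 / \<mu>"
  let ?SI = "\<lambda>y. LINT x|lborel. cnj (g x) * E (x - y)"
  let ?KI = "\<lambda>y. LINT x|lborel. cnj (g x) * complex_of_real (hermite_kernel n x y)"
  have kint: "integrable lborel (\<lambda>x. cnj (g x) * complex_of_real (hermite_kernel n x y))" for y
  proof -
    have "integrable lborel (\<lambda>x. cnj (g x) * hermite_cfun k x)" for k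
      using integrable_mult_cnj[OF square_integrable_hermite L2_suppD(1)[OF g], of k] by (simp add: mult.commute)
    then show ?thesis
      by (simp add: hermite_kernel_def sum_distrib_left flip: mult.assoc)
  qed
  have pt: "cmod (u y * (1 / (2 * pi) * ?SI y - ?KI y)) \<le> cmod (u y) * (?B * (LINT x|lborel. cmod (g x)))" for y
  proof (cases "y \<in> {-T..T}")
    case False
    then show ?thesis using L2_suppD(4)[OF u] by simp
  next
    case True
    have "1 / (2 * pi) * ?SI y - ?KI y = (LINT x|lborel. 1 / (2 * pi) * (cnj (g x) * E (x - y)) - cnj (g x) * complex_of_real (hermite_kernel n x y))"
      using S(2)[of y] kint[of y] by simp
    also have "cmod \<dots> \<le> (LINT x|lborel. ?B * cmod (g x))"
    proof (rule norm_integral_le_AE)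
      show "integrable lborel (\<lambda>x. 1 / (2 * pi) * (cnj (g x) * E (x - y)) - cnj (g x) * complex_of_real (hermite_kernel n x y))"
        using S(2)[of y] kint[of y] by simp
      show "integrable lborel (\<lambda>x. ?B * cmod (g x))" using i by simp
      \<comment> \<open>The sine quotient represents \<open>E\<close> only off the diagonal, which
        for fixed y is a null set in x.\<close>
      have "AE x in lborel. x \<noteq> y" by (rule AE_lborel_singleton)
      then show "AE x in lborel. norm (1 / (2 * pi) * (cnj (g x) * E (x - y)) - cnj (g x) * complex_of_real (hermite_kernel n x y)) \<le> ?B * cmod (g x)"
      proof eventually_elim
        case (elim x)
        show ?case
        proof (cases "x \<in> {-T..T}")
          case False
          then show ?thesis using L2_suppD(4)[OF g] by simp
        next
          case x: True
          have "1 / (2 * pi) * (cnj (g x) * E (x - y)) - cnj (g x) * complex_of_real (hermite_kernel n x y)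
              = - cnj (g x) * of_real (hermite_kernel n x y - sin (\<mu> * (x - y)) / (pi * (x - y)))"
            unfolding E_def using elim mu by (subst integral_cis_Icc) (auto simp: field_simps)
          also have "cmod \<dots> = cmod (g x) * \<bar>hermite_kernel n x y - sin (\<mu> * (x - y)) / (pi * (x - y))\<bar>"
            by (simp only: norm_mult norm_minus_cancel complex_mod_cnj norm_of_real)
          also have "\<dots> \<le> cmod (g x) * ?B"
            unfolding \<mu>_def by (intro mult_left_mono hermite_kernel_sinc T) (use x True elim in auto)
          finally show ?thesis by (simp only: mult.commute)
        qed
      qed
    qed
    also have "\<dots> = ?B * (LINT x|lborel. cmod (g x))" by simp
    finally show ?thesis by (simp only: norm_mult mult_left_mono norm_ge_zero)
  qed
  have "(LINT \<omega>|lborel. complex_of_real (indicator {-\<mu>..\<mu>} \<omega>) * (fourier u \<omega> * cnj (fourier g \<omega>))) - L2_inner (hermite_proj n u) g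
     = (LINT y|lborel. 1 / (2 * pi) * (u y * ?SI y) - u y * ?KI y)"
    unfolding S(3) K(2) using S(1) K(1) by simp
  also have "\<dots> = (LINT y|lborel. u y * (1 / (2 * pi) * ?SI y - ?KI y))"
    by (simp add: algebra_simps)
  also have "cmod \<dots> \<le> (LINT y|lborel. cmod (u y) * (?B * (LINT x|lborel. cmod (g x))))"
  proof (rule norm_integral_le_AE)
    show "integrable lborel (\<lambda>y. u y * (1 / (2 * pi) * ?SI y - ?KI y))"
    proof -
      have "integrable lborel (\<lambda>y. 1 / (2 * pi) * (u y * ?SI y) - u y * ?KI y)"
        using S(1) K(1) by simp
      then show ?thesis by (simp add: algebra_simps)
    qed
    show "integrable lborel (\<lambda>y. cmod (u y) * (?B * (LINT x|lborel. cmod (g x))))"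
      using i by simp
  qed (rule AE_I2[OF pt])
  also have "\<dots> = ?B * (LINT y|lborel. cmod (u y)) * (LINT x|lborel. cmod (g x))"
    by simp
  also have "\<dots> \<le> ?B * (sqrt (2 * T) * L2_norm_R u) * (sqrt (2 * T) * L2_norm_R g)"
    using mu by (intro mult_mono mult_left_mono L2_suppD(5)[OF u] L2_suppD(5)[OF g])
       (use T(1) in \<open>auto intro!: mult_nonneg_nonneg simp: L2_norm_nonneg\<close>)
  also have "\<dots> = ?B * (sqrt (2 * T) * sqrt (2 * T)) * L2_norm_R u * L2_norm_R g"
    by (simp only: mult_ac)
  also have "sqrt (2 * T) * sqrt (2 * T) = 2 * T" using T(1) by simp
  also have "?B * (2 * T) = 14 * T ^ 3 / \<mu>" by (simp add: power2_eq_square power3_eq_cube)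
  finally show ?thesis .
qed

section \<open>Frequency tail and the final estimate\<close>

lemma L2_supp_restrict:
  assumes "square_integrable f" "0 \<le> R"
  shows "L2_supp R (\<lambda>t. indicator {-R..R} t *\<^sub>R f t)"
  using square_integrable_restrict[OF assms(1), of "{-R..R}"] assms(2) by (auto simp: L2_supp_def)

lemma L2_norm_restrict: "L2_norm_R (\<lambda>t. indicator S t *\<^sub>R f t) = L2_norm_on S f"
proof -
  have "(cmod (indicator S t *\<^sub>R f t))\<^sup>2 = indicator S t *\<^sub>R (cmod (f t))\<^sup>2" for t
    by (simp add: indicator_def)
  then show ?thesis by (simp add: L2_norm_R_def L2_norm_on_def set_lebesgue_integral_def)
qed

lemma L2_norm_on_mono:
  assumes "square_integrable f" "S \<subseteq> S'" "S \<in> sets borel" "S' \<in> sets borel"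
  shows "L2_norm_on S f \<le> L2_norm_on S' f"
proof -
  have "(\<lambda>t. indicator S t *\<^sub>R (indicator S' t *\<^sub>R f t)) = (\<lambda>t. indicator S t *\<^sub>R f t)"
    using assms(2) by (auto simp: indicator_def fun_eq_iff)
  then show ?thesis
    using L2_norm_restrict_le[OF square_integrable_restrict[OF assms(1,4)] assms(3)]
    by (simp only: L2_norm_restrict[symmetric])
qed

text \<open>For R >= T the transform of f cut off to [-T,T] is F, minus the error of the cut-off at
  R, minus the transform of the piece of f with T < |t| <= R. The first part gives the tail of F,
  the third is bounded by the time tail of f through contractivity, and the second vanishes as R
  grows, while the left-hand side does not depend on R.\<close>

lemma fourier_tail_le:
  assumes f: "square_integrable f" and F: "is_fourier_L2 f F" and g: "L2_supp T g" and T: "0 \<le> T"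
  shows "cmod (LINT \<omega>|lborel. of_real (indicator {\<omega>. \<bar>\<omega>\<bar> > N} \<omega>) * (fourier (\<lambda>t. indicator {-T..T} t *\<^sub>R f t) \<omega> * cnj (fourier g \<omega>)))
     \<le> (L2_norm_on {\<omega>. \<bar>\<omega>\<bar> > N} F + L2_norm_on {t. \<bar>t\<bar> > T} f) * L2_norm_R g"
proof -
  let ?u = "\<lambda>R t. indicator {-R..R} t *\<^sub>R f t"
  let ?S = "{\<omega>. \<bar>\<omega>\<bar> > N}"
  have S [measurable]: "?S \<in> sets borel" by measurable
  have sF: "square_integrable F" using F by (simp add: is_fourier_L2_def)
  have su: "square_integrable (fourier (?u R))" if "0 \<le> R" for R
    by (rule fourier_L2(1)[OF L2_supp_restrict[OF f that]])
  have sg: "square_integrable (fourier g)" by (rule fourier_L2(1)[OF g])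
  have "fourier (?u R) \<omega> = complex_of_real (1 / sqrt (2 * pi)) * (LINT t:{-R..R}|lborel. f t * cis (- (t * \<omega>)))" for R \<omega>
    by (simp add: fourier_def set_lebesgue_integral_def)
  then have lim: "((\<lambda>R. LINT \<omega>|lborel. (cmod (F \<omega> - fourier (?u R) \<omega>))\<^sup>2) \<longlongrightarrow> 0) at_top"
    using F by (simp add: is_fourier_L2_def)
  define X where "X = cmod (LINT \<omega>|lborel. of_real (indicator ?S \<omega>) * (fourier (?u T) \<omega> * cnj (fourier g \<omega>)))"
  have bound: "X \<le> (L2_norm_on ?S F + L2_norm_R (\<lambda>\<omega>. F \<omega> - fourier (?u R) \<omega>) + L2_norm_on {t. \<bar>t\<bar> > T} f) * L2_norm_R g"
    if R: "R \<ge> T" for R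
  proof -
    let ?r = "\<lambda>S f \<omega>. indicator S \<omega> *\<^sub>R (f \<omega> :: complex)"
    let ?d = "\<lambda>\<omega>. F \<omega> - fourier (?u R) \<omega>"
    let ?v = "\<lambda>t. ?u R t - ?u T t"
    have R0: "0 \<le> R" using T R by simp
    have supp: "L2_supp R (?u R)" "L2_supp R (?u T)"
      using L2_supp_restrict[OF f R0] L2_supp_restrict[OF f T] R by (auto simp: L2_supp_def)
    have v: "L2_supp R ?v" by (rule L2_supp_diff[OF supp])
    have sd: "square_integrable ?d" by (intro square_integrable_diff sF su R0)
    have sv: "square_integrable (fourier ?v)" by (rule fourier_L2(1)[OF v])
    have fv: "fourier ?v \<omega> = fourier (?u R) \<omega> - fourier (?u T) \<omega>" for \<omega>
      by (rule fourier_diff) (rule L2_suppD(3)[OF supp(1)] L2_suppD(3)[OF supp(2)])+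
    have e: "of_real (indicator ?S \<omega>) * (fourier (?u T) \<omega> * cnj (fourier g \<omega>))
       = (?r ?S F \<omega> - ?r ?S ?d \<omega> - ?r ?S (fourier ?v) \<omega>) * cnj (fourier g \<omega>)" for \<omega>
      by (cases "\<omega> \<in> ?S") (simp_all only: indicator_simps fv scaleR_one scaleR_zero_left of_real_1 of_real_0, simp_all)
    note r = square_integrable_restrict[OF sF S] square_integrable_restrict[OF sd S] square_integrable_restrict[OF sv S]
    have "(LINT \<omega>|lborel. of_real (indicator ?S \<omega>) * (fourier (?u T) \<omega> * cnj (fourier g \<omega>)))
       = L2_inner (\<lambda>\<omega>. ?r ?S F \<omega> - ?r ?S ?d \<omega> - ?r ?S (fourier ?v) \<omega>) (fourier g)"
      unfolding e L2_inner_def ..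
    also have "\<dots> = L2_inner (?r ?S F) (fourier g) - L2_inner (?r ?S ?d) (fourier g) - L2_inner (?r ?S (fourier ?v)) (fourier g)"
      by (simp only: L2_inner_diff_left r sg square_integrable_diff)
    finally have "X \<le> cmod (L2_inner (?r ?S F) (fourier g)) + cmod (L2_inner (?r ?S ?d) (fourier g)) + cmod (L2_inner (?r ?S (fourier ?v)) (fourier g))"
      unfolding X_def by (simp only:) (intro order_trans[OF norm_triangle_ineq4] add_mono norm_triangle_ineq4 order_refl)
    also have "\<dots> \<le> L2_norm_R (?r ?S F) * L2_norm_R (fourier g) + L2_norm_R (?r ?S ?d) * L2_norm_R (fourier g) + L2_norm_R (?r ?S (fourier ?v)) * L2_norm_R (fourier g)"
      by (intro add_mono Cauchy_Schwarz_L2 r sg)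
    also have "\<dots> = (L2_norm_R (?r ?S F) + L2_norm_R (?r ?S ?d) + L2_norm_R (?r ?S (fourier ?v))) * L2_norm_R (fourier g)"
      by (simp add: algebra_simps)
    also have "\<dots> \<le> (L2_norm_on ?S F + L2_norm_R ?d + L2_norm_on {t. \<bar>t\<bar> > T} f) * L2_norm_R g"
    proof (intro mult_mono add_mono fourier_L2(2)[OF g])
      show "L2_norm_R (?r ?S F) \<le> L2_norm_on ?S F" by (simp only: L2_norm_restrict)
      show "L2_norm_R (?r ?S ?d) \<le> L2_norm_R ?d" by (rule L2_norm_restrict_le[OF sd S])
      have "L2_norm_R (?r ?S (fourier ?v)) \<le> L2_norm_R (fourier ?v)" by (rule L2_norm_restrict_le[OF sv S])
      also have "\<dots> \<le> L2_norm_R ?v" by (rule fourier_L2(2)[OF v])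
      also have "L2_norm_R ?v = L2_norm_on ({-R..R} - {-T..T}) f"
      proof -
        have "?v = ?r ({-R..R} - {-T..T}) f" using R by (auto simp: indicator_def fun_eq_iff)
        then show ?thesis by (simp only: L2_norm_restrict)
      qed
      also have "\<dots> \<le> L2_norm_on {t. \<bar>t\<bar> > T} f"
        by (intro L2_norm_on_mono f) auto
      finally show "L2_norm_R (?r ?S (fourier ?v)) \<le> L2_norm_on {t. \<bar>t\<bar> > T} f" .
    qed (simp_all add: L2_norm_nonneg flip: L2_norm_restrict)
    finally show ?thesis .
  qed
  have "((\<lambda>R. (L2_norm_on ?S F + L2_norm_R (\<lambda>\<omega>. F \<omega> - fourier (?u R) \<omega>) + L2_norm_on {t. \<bar>t\<bar> > T} f) * L2_norm_R g)
     \<longlongrightarrow> (L2_norm_on ?S F + sqrt 0 + L2_norm_on {t. \<bar>t\<bar> > T} f) * L2_norm_R g) at_top"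
    unfolding L2_norm_R_def[of "\<lambda>\<omega>. F \<omega> - _ \<omega>"]
    by (intro tendsto_intros lim)
  then have "X \<le> (L2_norm_on ?S F + sqrt 0 + L2_norm_on {t. \<bar>t\<bar> > T} f) * L2_norm_R g"
    by (rule tendsto_lowerbound) (rule eventually_mono[OF eventually_ge_at_top[of T] bound], simp_all)
  then show ?thesis by (simp add: X_def)
qed

theorem theorem1:
  fixes f F :: "real \<Rightarrow> complex" and \<Omega>0 T0 \<epsilon>T \<epsilon>\<Omega> T :: real and n :: nat
  assumes "\<Omega>0 \<ge> 2" and "T0 \<ge> 2" and "\<epsilon>T > 0" and "\<epsilon>\<Omega> > 0"
    and "square_integrable f"
    and "is_fourier_L2 f F"
    and "(LINT t:{t. \<bar>t\<bar> > T0}|lborel. (cmod (f t))\<^sup>2) \<le> \<epsilon>T\<^sup>2 * (L2_norm_R f)\<^sup>2"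
    and "(LINT \<omega>:{\<omega>. \<bar>\<omega>\<bar> > \<Omega>0}|lborel. (cmod (F \<omega>))\<^sup>2) \<le> \<epsilon>\<Omega>\<^sup>2 * (L2_norm_R f)\<^sup>2"
    and "T \<ge> T0"
    and "real n \<ge> max (2 * T\<^sup>2) (2 * \<Omega>0\<^sup>2)"
  shows "L2_norm_on {-T..T} (\<lambda>t. f t - hermite_proj n f t)
         \<le> (2 * \<epsilon>T + \<epsilon>\<Omega> + 34 * T ^ 3 / sqrt (2 * real n + 1)) * L2_norm_R f"
proof -
  note f = assms(5)
  define \<mu> where "\<mu> = sqrt (2 * real n + 2)"
  define \<nu> where "\<nu> = L2_norm_R f"
  have nu: "0 \<le> \<nu>" by (simp add: \<nu>_def L2_norm_nonneg)
  have T2: "2 \<le> T" using assms by simp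
  have mu: "0 < \<mu>" by (simp add: \<mu>_def)
  have lam: "sqrt (2 * real n + 1) \<le> \<mu>" by (simp add: \<mu>_def)
  let ?w = "\<lambda>t. f t - hermite_proj n f t"
  have w: "square_integrable ?w" by (intro square_integrable_diff f square_integrable_hermite_proj)
  define g where "g = (\<lambda>t. indicator {-T..T} t *\<^sub>R ?w t)"
  have gn: "L2_norm_on {-T..T} ?w = L2_norm_R g"
    unfolding g_def by (rule L2_norm_restrict[symmetric])
  show ?thesis
  proof (cases "4 * T \<le> \<mu>")
    case False
    have "L2_norm_R g \<le> L2_norm_R ?w" unfolding g_def by (rule L2_norm_restrict_le[OF w]) simp
    also have "\<dots> \<le> 1 * \<nu>" using L2_norm_hermite_proj_compl[OF f] by (simp add: \<nu>_def)
    also have "\<dots> \<le> (2 * \<epsilon>T + \<epsilon>\<Omega> + 34 * T ^ 3 / sqrt (2 * real n + 1)) * \<nu>"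
    proof (intro mult_right_mono nu)
      \<comment> \<open>Once T <= T^3 is known, mu < 4T makes the third term in the bracket alone at
        least 1.\<close>
      have "1 \<le> T ^ 2" using T2 by simp
      then have "T * 1 \<le> T * T ^ 2" using T2 by (intro mult_left_mono) auto
      then have "T \<le> T ^ 3" by (simp add: power3_eq_cube power2_eq_square)
      then have "sqrt (2 * real n + 1) \<le> 34 * T ^ 3" using lam False T2 by linarith
      then have "1 \<le> 34 * T ^ 3 / sqrt (2 * real n + 1)" by (simp add: le_divide_eq_1)
      then show "1 \<le> 2 * \<epsilon>T + \<epsilon>\<Omega> + 34 * T ^ 3 / sqrt (2 * real n + 1)" using assms(3,4) by linarith
    qed
    finally show ?thesis unfolding gn \<nu>_def .
  next
    case True
    have T0: "0 \<le> T" using T2 by simp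
    define u where "u = (\<lambda>t. indicator {-T..T} t *\<^sub>R f t)"
    \<comment> \<open>The projection is not local: the part of f outside [-T,T] still contributes to
      \<open>hermite_proj n f\<close> inside. That part is split off here, and the kernel comparison
      is applied to u only.\<close>
    define r where "r = (\<lambda>t. indicator {t. \<bar>t\<bar> > T} t *\<^sub>R f t)"
    have u: "L2_supp T u" unfolding u_def by (rule L2_supp_restrict[OF f T0])
    have g: "L2_supp T g" unfolding g_def by (rule L2_supp_restrict[OF w T0])
    have r: "square_integrable r" unfolding r_def by (rule square_integrable_restrict[OF f]) measurable
    note sq = L2_suppD(1)[OF u] L2_suppD(1)[OF g]
    have rle: "L2_norm_on {t. \<bar>t\<bar> > T} f \<le> \<epsilon>T * \<nu>"
    proof -
      have "L2_norm_on {t. \<bar>t\<bar> > T} f \<le> L2_norm_on {t. \<bar>t\<bar> > T0} f"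
        using assms(9) by (intro L2_norm_on_mono f) auto
      also have "\<dots> \<le> \<epsilon>T * \<nu>"
        unfolding L2_norm_on_def using assms(3,7) nu
        by (intro real_le_lsqrt) (simp_all add: \<nu>_def power_mult_distrib)
      finally show ?thesis .
    qed
    have Fle: "L2_norm_on {\<omega>. \<bar>\<omega>\<bar> > \<mu>} F \<le> \<epsilon>\<Omega> * \<nu>"
    proof -
      have "\<Omega>0\<^sup>2 \<le> \<mu>\<^sup>2" using assms(10) by (simp add: \<mu>_def)
      then have "\<Omega>0 \<le> \<mu>" by (rule power2_le_imp_le) (use mu in simp)
      moreover have "square_integrable F" using assms(6) by (simp add: is_fourier_L2_def)
      ultimately have "L2_norm_on {\<omega>. \<bar>\<omega>\<bar> > \<mu>} F \<le> L2_norm_on {\<omega>. \<bar>\<omega>\<bar> > \<Omega>0} F"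
        by (intro L2_norm_on_mono) auto
      also have "\<dots> \<le> \<epsilon>\<Omega> * \<nu>"
        unfolding L2_norm_on_def using assms(4,8) nu
        by (intro real_le_lsqrt) (simp_all add: \<nu>_def power_mult_distrib)
      finally show ?thesis .
    qed
    let ?fg = "\<lambda>\<omega>. fourier u \<omega> * cnj (fourier g \<omega>)"
    define A where "A = (LINT \<omega>|lborel. complex_of_real (indicator {-\<mu>..\<mu>} \<omega>) * ?fg \<omega>)"
    define B where "B = (LINT \<omega>|lborel. complex_of_real (indicator {\<omega>. \<bar>\<omega>\<bar> > \<mu>} \<omega>) * ?fg \<omega>)"
    have ug: "L2_inner u g = A + B"
    proof -
      have i: "integrable lborel ?fg" by (intro integrable_mult_cnj fourier_L2(1)[OF u] fourier_L2(1)[OF g])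
      have iS: "integrable lborel (\<lambda>\<omega>. complex_of_real (indicator S \<omega>) * ?fg \<omega>)" if "S \<in> sets borel" for S
        using integrable_mult_indicator[OF _ i, of S] that by (simp add: scaleR_conv_of_real)
      have "L2_inner u g = (LINT \<omega>|lborel. ?fg \<omega>)"
        using parseval[OF u g] by (simp add: L2_inner_def)
      also have "\<dots> = (LINT \<omega>|lborel. complex_of_real (indicator {-\<mu>..\<mu>} \<omega>) * ?fg \<omega> + complex_of_real (indicator {\<omega>. \<bar>\<omega>\<bar> > \<mu>} \<omega>) * ?fg \<omega>)"
        by (intro Bochner_Integration.integral_cong refl) (auto simp: indicator_def)
      also have "\<dots> = A + B"
        unfolding A_def B_def by (intro Bochner_Integration.integral_add iS) simp_all
      finally show ?thesis .
    qed
    have B: "cmod B \<le> (\<epsilon>\<Omega> * \<nu> + \<epsilon>T * \<nu>) * L2_norm_R g"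
      using fourier_tail_le[OF f assms(6) g T0, of \<mu>] Fle rle unfolding B_def u_def
      by (elim order_trans) (intro mult_right_mono add_mono L2_norm_nonneg)
    have A: "cmod (A - L2_inner (hermite_proj n u) g) \<le> 34 * T ^ 3 / sqrt (2 * real n + 1) * \<nu> * L2_norm_R g"
    proof -
      have "cmod (A - L2_inner (hermite_proj n u) g) \<le> 14 * T ^ 3 / \<mu> * L2_norm_R u * L2_norm_R g"
        unfolding A_def \<mu>_def using True T2 by (intro hermite_proj_vs_band_limiting[OF u g]) (auto simp: \<mu>_def)
      also have "\<dots> \<le> 34 * T ^ 3 / sqrt (2 * real n + 1) * \<nu> * L2_norm_R g"
      proof (intro mult_mono L2_norm_nonneg order_refl mult_nonneg_nonneg)
        show "14 * T ^ 3 / \<mu> \<le> 34 * T ^ 3 / sqrt (2 * real n + 1)"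
          using lam T0 mu by (intro frac_le) auto
        show "L2_norm_R u \<le> \<nu>" unfolding u_def \<nu>_def by (rule L2_norm_restrict_le[OF f]) simp
      qed (use T0 nu in auto)
      finally show ?thesis .
    qed
    have C: "cmod (L2_inner (hermite_proj n r) g) \<le> \<epsilon>T * \<nu> * L2_norm_R g"
    proof -
      have "L2_norm_R r \<le> \<epsilon>T * \<nu>" unfolding r_def L2_norm_restrict by (rule rle)
      then show ?thesis
        using L2_inner_hermite_proj_le[OF r sq(2), of n] mult_right_mono[OF _ L2_norm_nonneg] order_trans by blast
    qed
    have split: "hermite_proj n f t = hermite_proj n u t + hermite_proj n r t" for t
    proof -
      have "f = (\<lambda>t. u t + r t)" by (auto simp: u_def r_def indicator_def fun_eq_iff)
      moreover have "L2_inner (\<lambda>t. u t + r t) (hermite_cfun k) = L2_inner u (hermite_cfun k) + L2_inner r (hermite_cfun k)" for k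
        using integrable_mult_cnj[OF sq(1) square_integrable_hermite] integrable_mult_cnj[OF r square_integrable_hermite]
        by (simp add: L2_inner_def distrib_right)
      ultimately show ?thesis
        by (simp add: hermite_proj_def distrib_right sum.distrib)
    qed
    have "complex_of_real ((L2_norm_R g)\<^sup>2) = L2_inner g g" by (rule L2_inner_self[symmetric])
    \<comment> \<open>Because g vanishes outside [-T,T], where u and f may differ, f itself can be
      replaced by u; under the projection both u and r must stay.\<close>
    also have "\<dots> = L2_inner (\<lambda>t. (u t - hermite_proj n u t) - hermite_proj n r t) g"
      unfolding L2_inner_def
      by (intro Bochner_Integration.integral_cong refl) (simp add: g_def u_def[symmetric] split, simp add: u_def indicator_def)
    also have "\<dots> = L2_inner u g - L2_inner (hermite_proj n u) g - L2_inner (hermite_proj n r) g"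
      by (simp add: L2_inner_diff_left sq square_integrable_diff square_integrable_hermite_proj)
    also have "\<dots> = (A - L2_inner (hermite_proj n u) g) + B - L2_inner (hermite_proj n r) g"
      unfolding ug by simp
    finally have "(L2_norm_R g)\<^sup>2 = cmod \<dots>"
      by (metis abs_power2 norm_of_real)
    also have "\<dots> \<le> cmod (A - L2_inner (hermite_proj n u) g) + cmod B + cmod (L2_inner (hermite_proj n r) g)"
      by (intro order_trans[OF norm_triangle_ineq4] add_mono norm_triangle_ineq order_refl)
    also have "\<dots> \<le> 34 * T ^ 3 / sqrt (2 * real n + 1) * \<nu> * L2_norm_R g + (\<epsilon>\<Omega> * \<nu> + \<epsilon>T * \<nu>) * L2_norm_R g + \<epsilon>T * \<nu> * L2_norm_R g"
      by (intro add_mono A B C)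
    also have "\<dots> = (2 * \<epsilon>T + \<epsilon>\<Omega> + 34 * T ^ 3 / sqrt (2 * real n + 1)) * \<nu> * L2_norm_R g"
      by (simp add: algebra_simps)
    finally have le: "L2_norm_R g * L2_norm_R g \<le> (2 * \<epsilon>T + \<epsilon>\<Omega> + 34 * T ^ 3 / sqrt (2 * real n + 1)) * \<nu> * L2_norm_R g"
      by (simp only: power2_eq_square)
    have "L2_norm_R g \<le> (2 * \<epsilon>T + \<epsilon>\<Omega> + 34 * T ^ 3 / sqrt (2 * real n + 1)) * \<nu>"
    proof (cases "L2_norm_R g = 0")
      case True
      then show ?thesis using assms(3,4) T0 nu by (auto intro!: mult_nonneg_nonneg add_nonneg_nonneg)
    next
      case False
      then have "0 < L2_norm_R g" using L2_norm_nonneg[of g] by simp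
      then show ?thesis using le by (rule mult_right_le_imp_le[rotated])
    qed
    then show ?thesis unfolding gn \<nu>_def .
  qed
qed

end
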